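(* Let $G$ be a finite group. (a) If $o(G)<\frac{13}{6}=o(S_3)$, then $G$ is an elementary abelian $2$-group. (b) If $o(G)<\frac{11}{4}=o(C_4)$, then $G$ is solvable.
   Context: For a finite group $G$ and $x\in G$, $o(x)$ denotes the order of the element $x$. The sum of element orders is $\psi(G)=\sum_{x\in G}o(x)$, and the average order of $G$ is $o(G)=\frac{\psi(G)}{|G|}$. $C_n$ is the cyclic group of order $n$ and $S_3$ is the symmetric group on three letters. An elementary abelian $2$-group is a group isomorphic to $C_2^m$ for some integer $m\geq 0$; in particular, the trivial group counts as an elementary abelian $2$-group. *)

theory Defs
  imports
    Complex_Main
    "HOL-Algebra.Multiplicative_Group"
    "HOL-Algebra.Elementary_Groups"
    "HOL-Algebra.Product_Groups"
    "HOL-Algebra.Solvable_Groups"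
    "HOL-Algebra.Sym_Groups"
begin

definition psi :: "('a, 'b) monoid_scheme \<Rightarrow> nat"
  where "psi G = (\<Sum>x\<in>carrier G. group.ord G x)"

definition avg_order :: "('a, 'b) monoid_scheme \<Rightarrow> real"
  where "avg_order G = real (psi G) / real (order G)"

text \<open>The case \<open>m = 0\<close> (empty product) is the trivial group.\<close>
definition elementary_abelian_2_group :: "('a, 'b) monoid_scheme \<Rightarrow> bool"
  where "elementary_abelian_2_group G \<longleftrightarrow>
    (\<exists>m::nat. G \<cong> product_group {..<m} (\<lambda>_. integer_mod_group 2))"

end

theory Submission
  imports Defs "HOL-Algebra.Sylow"
begin

text \<open>
  Let \<open>n\<close> be the order of \<open>G\<close>, let \<open>i\<close> be the number of solutions of \<open>x\<^sup>2 = 1\<close> and let \<open>r\<close> be the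
  number of elements of order at least four. All remaining elements have order three, so
  \<open>psi G \<ge> 3 n - i + r - 1\<close> (\<open>psi_lower_bound\<close>): a small average order forces many involutions.

  For the first claim, \<open>psi G < 13 n / 6\<close> gives \<open>i > 5 n / 6 - 1\<close>. If \<open>i > 3 n / 4\<close>, each
  solution \<open>x\<close> of \<open>x\<^sup>2 = 1\<close> commutes with more than half of the group, hence is central, and \<open>G\<close>
  has exponent two (\<open>exponent_two_of_many\<close>). Otherwise \<open>n < 12\<close>, and divisibility of \<open>n\<close> by
  three rules out the few remaining possibilities.

  For the second claim, the average order does not grow when passing to a quotient
  (\<open>psi_quotient_le\<close>), so \<open>G\<close> may be divided by its largest solvable normal subgroup. In
  that quotient every nontrivial conjugacy class has at least five elements: \<open>G\<close> acts on a smaller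
  class through a subgroup of the symmetric group on four letters, whose third derived subgroup is
  trivial, and so the class would generate a solvable normal subgroup
  (\<open>generate_small_class_solvable\<close>). It remains to see that a group with no small class and with
  \<open>4 i + 4 > n + 4 r\<close> is trivial (\<open>order_eq_one\<close>), which is a matter of counting.

  To this end fix an involution \<open>t\<close> with centralizer of order \<open>c\<close> and pair \<open>y\<close> with \<open>t y\<close>. If \<open>s\<close> is
  an involution for which \<open>t s\<close> has order three, then \<open>s\<close> is conjugate to \<open>t\<close>; all other pairs
  that contain an involution either lie in the centralizer of \<open>t\<close> or contain an element of order at
  least four. Therefore \<open>c + n / c\<close> exceeds \<open>n / 4\<close>. As \<open>n / c \<ge> 5\<close>, only few values of \<open>c\<close> survive, and
  a look at each of them leaves \<open>c = 4\<close> (\<open>card_cent_involution\<close>). Now every class of involutions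
  has \<open>n / 4\<close> elements, and the same pairing, this time used to count all elements, shows that there
  are exactly two such classes and that \<open>t\<close> inverts all but at most two elements of order three
  (\<open>half_involutions\<close>). But an element \<open>x\<close> of order three is inverted by at most as many
  involutions as its centralizer has elements, that is by at most \<open>n / 5\<close> of the \<open>n / 2\<close> involutions, and
  there are at least five such \<open>x\<close>. Counting the pairs of an involution and an element of order three
  which it does not invert in two ways gives a contradiction.
\<close>

section \<open>Conjugation and centralizers in a finite group\<close>

locale finite_group = group +
  assumes finite_carrier [simp]: "finite (carrier G)"

context group
begin

definition conjugate :: "'a \<Rightarrow> 'a \<Rightarrow> 'a"
  where "conjugate g x = g \<otimes> x \<otimes> inv g"

definition cent :: "'a \<Rightarrow> 'a set"
  where "cent x = {g \<in> carrier G. g \<otimes> x = x \<otimes> g}"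

definition conj_class :: "'a \<Rightarrow> 'a set"
  where "conj_class x = (\<lambda>g. conjugate g x) ` carrier G"

definition sq_one :: "'a set"
  where "sq_one = {x \<in> carrier G. x \<otimes> x = \<one>}"

text \<open>
  An equation rather than a condition on \<open>ord\<close>, so that membership is established by computing
  with words in the group.
\<close>

definition ord_three :: "'a set"
  where "ord_three = {x \<in> carrier G. x \<noteq> \<one> \<and> x \<otimes> (x \<otimes> x) = \<one>}"

text \<open>
  In a finite group these are the elements of order at least four.
\<close>

definition high_ord :: "'a set"
  where "high_ord = carrier G - sq_one - ord_three"

lemma conjugate_closed [simp]: "g \<in> carrier G \<Longrightarrow> x \<in> carrier G \<Longrightarrow> conjugate g x \<in> carrier G"
  by (simp add: conjugate_def)

lemma mult_inv_cancel [simp]: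
  assumes "x \<in> carrier G" "y \<in> carrier G"
  shows "x \<otimes> (inv x \<otimes> y) = y" "inv x \<otimes> (x \<otimes> y) = y"
  using assms by (simp_all flip: m_assoc)

lemma conjugate_mult:
  assumes "g \<in> carrier G" "x \<in> carrier G" "y \<in> carrier G"
  shows "conjugate g (x \<otimes> y) = conjugate g x \<otimes> conjugate g y"
  using assms by (simp add: conjugate_def m_assoc)

lemma conjugate_comp:
  assumes "g \<in> carrier G" "h \<in> carrier G" "x \<in> carrier G"
  shows "conjugate (g \<otimes> h) x = conjugate g (conjugate h x)"
  using assms by (simp add: conjugate_def m_assoc inv_mult_group)

lemma conjugate_one_left [simp]: "x \<in> carrier G \<Longrightarrow> conjugate \<one> x = x"
  by (simp add: conjugate_def)

lemma conjugate_one_right [simp]: "g \<in> carrier G \<Longrightarrow> conjugate g \<one> = \<one>"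
  by (simp add: conjugate_def)

lemma conjugate_eq_iff:
  assumes "g \<in> carrier G" "x \<in> carrier G" "y \<in> carrier G"
  shows "conjugate g x = y \<longleftrightarrow> g \<otimes> x = y \<otimes> g"
  using assms by (metis conjugate_def inv_closed inv_solve_right m_closed)

lemma conjugate_self_iff:
  assumes "g \<in> carrier G" "x \<in> carrier G"
  shows "conjugate g x = x \<longleftrightarrow> g \<in> cent x"
  using assms by (simp add: cent_def conjugate_eq_iff)

lemma conjugate_inv_cancel [simp]:
  assumes "g \<in> carrier G" "x \<in> carrier G"
  shows "conjugate (inv g) (conjugate g x) = x" "conjugate g (conjugate (inv g) x) = x"
  using assms by (simp_all flip: conjugate_comp)

lemma conjugate_inject [simp]:
  assumes "g \<in> carrier G" "x \<in> carrier G" "y \<in> carrier G"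
  shows "conjugate g x = conjugate g y \<longleftrightarrow> x = y"
  using assms by (metis conjugate_inv_cancel(1))

lemma conjugate_eq_one [simp]:
  assumes "g \<in> carrier G" "x \<in> carrier G"
  shows "conjugate g x = \<one> \<longleftrightarrow> x = \<one>"
  using conjugate_inject[of g x \<one>] assms by simp

lemma cent_sub: "cent x \<subseteq> carrier G"
  by (auto simp: cent_def)

lemma cent_sym: "x \<in> carrier G \<Longrightarrow> y \<in> cent x \<Longrightarrow> x \<in> cent y"
  by (auto simp: cent_def)

lemma cent_mult_base:
  assumes "x \<in> carrier G" "y \<in> carrier G" "g \<in> cent x" "g \<in> cent y"
  shows "g \<in> cent (x \<otimes> y)"
proof -
  have g: "g \<in> carrier G" using assms(3) cent_sub by blast
  show ?thesis using assms g conjugate_mult[OF g assms(1,2)] by (simp flip: conjugate_self_iff)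
qed

lemma subgroup_cent: "x \<in> carrier G \<Longrightarrow> subgroup (cent x) G"
proof (rule subgroupI)
  assume x: "x \<in> carrier G"
  show "cent x \<subseteq> carrier G" by (rule cent_sub)
  show "cent x \<noteq> {}" using x by (auto simp: cent_def)
  show "inv a \<in> cent x" if "a \<in> cent x" for a
  proof -
    have a: "a \<in> carrier G" "conjugate a x = x" using that x cent_sub conjugate_self_iff by blast+
    have "conjugate (inv a) (conjugate a x) = x" using a(1) x by (rule conjugate_inv_cancel)
    thus ?thesis using a x conjugate_self_iff[of "inv a" x] by simp
  qed
  show "a \<otimes> b \<in> cent x" if "a \<in> cent x" "b \<in> cent x" for a b
  proof -
    have a: "a \<in> carrier G" "conjugate a x = x" "b \<in> carrier G" "conjugate b x = x"
      using that x cent_sub conjugate_self_iff by blast+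
    thus ?thesis using x conjugate_self_iff[of "a \<otimes> b" x] by (simp add: conjugate_comp)
  qed
qed

lemma self_in_cent: "x \<in> carrier G \<Longrightarrow> x \<in> cent x"
  by (simp add: cent_def)

lemma conj_class_sub: "x \<in> carrier G \<Longrightarrow> conj_class x \<subseteq> carrier G"
  by (auto simp: conj_class_def)

lemma self_in_conj_class: "x \<in> carrier G \<Longrightarrow> x \<in> conj_class x"
  unfolding conj_class_def by (rule image_eqI[of _ _ \<one>]) simp_all

lemma conjugate_in_conj_class: "g \<in> carrier G \<Longrightarrow> conjugate g x \<in> conj_class x"
  by (simp add: conj_class_def)

lemma conj_class_conj:
  assumes "g \<in> carrier G" "x \<in> carrier G" "y \<in> conj_class x"
  shows "conjugate g y \<in> conj_class x"
proof -
  obtain h where h: "h \<in> carrier G" "y = conjugate h x" using assms(3) by (auto simp: conj_class_def)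
  hence "conjugate g y = conjugate (g \<otimes> h) x" using assms by (simp add: conjugate_comp)
  thus ?thesis using assms h by (simp add: conjugate_in_conj_class)
qed

lemma conj_class_eq:
  assumes "x \<in> carrier G" "y \<in> conj_class x"
  shows "conj_class y = conj_class x"
proof -
  obtain h where h: "h \<in> carrier G" "y = conjugate h x" using assms(2) by (auto simp: conj_class_def)
  have 1: "x \<in> conj_class y"
    using conjugate_in_conj_class[of "inv h" y] h assms(1) by simp
  have sub: "conj_class b \<subseteq> conj_class a" if "a \<in> carrier G" "b \<in> conj_class a" for a b
    using conj_class_conj[OF _ that] by (auto simp: conj_class_def[of b])
  show ?thesis using sub[OF assms] sub[OF _ 1] h assms(1) by auto
qed

lemma conjugate_sq_one: "g \<in> carrier G \<Longrightarrow> x \<in> sq_one \<Longrightarrow> conjugate g x \<in> sq_one"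
  unfolding sq_one_def by (simp flip: conjugate_mult)

lemma conjugate_ord_three: "g \<in> carrier G \<Longrightarrow> x \<in> ord_three \<Longrightarrow> conjugate g x \<in> ord_three"
  unfolding ord_three_def by (simp flip: conjugate_mult)

lemma sq_one_sub: "sq_one \<subseteq> carrier G" by (auto simp: sq_one_def)
lemma ord_three_sub: "ord_three \<subseteq> carrier G" by (auto simp: ord_three_def)
lemma high_ord_sub: "high_ord \<subseteq> carrier G" by (auto simp: high_ord_def)

lemma one_sq_one [simp]: "\<one> \<in> sq_one" by (simp add: sq_one_def)

lemma sq_one_ord_three: "sq_one \<inter> ord_three = {}"
  by (auto simp: sq_one_def ord_three_def)

lemma sq_one_cancel:
  assumes "t \<in> sq_one" "y \<in> carrier G"
  shows "t \<otimes> (t \<otimes> y) = y"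
  using assms by (auto simp: sq_one_def simp flip: m_assoc)

lemma sq_one_cancel_right:
  assumes "t \<in> sq_one" "y \<in> carrier G"
  shows "y \<otimes> t \<otimes> t = y"
  using assms by (auto simp: sq_one_def m_assoc)

lemma sq_one_inv: "t \<in> sq_one \<Longrightarrow> inv t = t"
  by (auto simp: sq_one_def intro: inv_equality)

text \<open>
  A product of two elements of order at most two is self-inverse exactly if it equals its reversal.
\<close>

lemma sq_one_mult_iff:
  assumes "s \<in> sq_one" "t \<in> sq_one"
  shows "t \<otimes> s \<in> sq_one \<longleftrightarrow> s \<in> cent t"
proof -
  have c: "s \<in> carrier G" "t \<in> carrier G" using assms sq_one_sub by auto
  have "t \<otimes> s \<in> sq_one \<longleftrightarrow> inv (t \<otimes> s) = t \<otimes> s"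
    using c sq_one_inv[of "t \<otimes> s"] r_inv[of "t \<otimes> s"]
    by (metis (mono_tags, lifting) m_closed mem_Collect_eq sq_one_def)
  also have "\<dots> \<longleftrightarrow> s \<in> cent t"
    using c assms by (auto simp: inv_mult_group sq_one_inv cent_def)
  finally show ?thesis .
qed

lemma subgroup_order_two:
  assumes "t \<in> sq_one"
  shows "subgroup {\<one>, t} G"
  using assms sq_one_sub by (intro subgroupI) (auto simp: sq_one_def sq_one_inv)

lemma inj_mult_left: "t \<in> carrier G \<Longrightarrow> A \<subseteq> carrier G \<Longrightarrow> inj_on (\<lambda>y. t \<otimes> y) A"
  by (rule inj_onI) (metis mult_inv_cancel(2) subsetD)

end

context finite_group
begin

lemma finite_sub: "A \<subseteq> carrier G \<Longrightarrow> finite A"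
  using finite_carrier finite_subset by blast

lemmas finite_parts [simp] =
  finite_sub[OF sq_one_sub] finite_sub[OF ord_three_sub] finite_sub[OF high_ord_sub]
  finite_sub[OF cent_sub]

lemma finite_conj_class [simp]: "finite (conj_class x)"
  using finite_carrier by (simp add: conj_class_def)

text \<open>
  The elements that conjugate \<open>x\<close> to \<open>y\<close> form a coset of the centralizer of \<open>x\<close>.
\<close>

lemma card_transporter:
  assumes "x \<in> carrier G" "y \<in> conj_class x"
  shows "card {g \<in> carrier G. conjugate g x = y} = card (cent x)"
proof -
  obtain h where h: "h \<in> carrier G" "y = conjugate h x" using assms(2) by (auto simp: conj_class_def)
  have "{g \<in> carrier G. conjugate g x = y} = (\<lambda>g. h \<otimes> g) ` cent x"
  proof (intro equalityI subsetI)
    fix g assume "g \<in> {g \<in> carrier G. conjugate g x = y}"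
    hence g: "g \<in> carrier G" "conjugate g x = conjugate h x" using h by auto
    have "conjugate (inv h \<otimes> g) x = x" using g h assms(1) by (simp add: conjugate_comp)
    hence "inv h \<otimes> g \<in> cent x" using g h assms(1) conjugate_self_iff[of "inv h \<otimes> g" x] by simp
    moreover have "g = h \<otimes> (inv h \<otimes> g)" using g h by simp
    ultimately show "g \<in> (\<lambda>g. h \<otimes> g) ` cent x" by blast
  next
    fix g assume "g \<in> (\<lambda>g. h \<otimes> g) ` cent x"
    then obtain c where c: "c \<in> cent x" "g = h \<otimes> c" by blast
    moreover from c(1) have "c \<in> carrier G" using cent_sub by blast
    moreover have "conjugate c x = x" using calculation assms(1) conjugate_self_iff by blast
    ultimately show "g \<in> {g \<in> carrier G. conjugate g x = y}" using h assms(1) by (simp add: conjugate_comp)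
  qed
  thus ?thesis using inj_mult_left[OF h(1) cent_sub] by (simp add: card_image)
qed

lemma card_conj_class_cent:
  assumes "x \<in> carrier G"
  shows "card (conj_class x) * card (cent x) = order G"
proof -
  have "order G = (\<Sum>g\<in>carrier G. 1)" by (simp add: order_def)
  also have "\<dots> = (\<Sum>y\<in>conj_class x. \<Sum>g\<in>{g \<in> carrier G. conjugate g x = y}. 1)"
    unfolding conj_class_def by (rule sum.image_gen[OF finite_carrier])
  also have "\<dots> = (\<Sum>y\<in>conj_class x. card (cent x))"
    using card_transporter[OF assms] by (intro sum.cong) auto
  finally show ?thesis by simp
qed

lemma card_subgroup_dvd:
  assumes "subgroup H G" "subgroup K G" "H \<subseteq> K"
  shows "card H dvd card K"
proof -
  interpret K: group "G\<lparr>carrier := K\<rparr>" by (rule subgroup_imp_group[OF assms(2)])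
  have "subgroup H (G\<lparr>carrier := K\<rparr>)"
    using assms by (simp add: subgroup_incl)
  from K.lagrange[OF this] have "card (rcosets\<^bsub>G\<lparr>carrier := K\<rparr>\<^esub> H) * card H = card K"
    by (simp add: order_def)
  thus ?thesis by (metis dvd_triv_right)
qed

lemma card_parts: "card sq_one + card ord_three + card high_ord = order G"
proof -
  have "carrier G = (sq_one \<union> ord_three) \<union> high_ord"
    using sq_one_sub ord_three_sub by (auto simp: high_ord_def)
  hence "order G = card ((sq_one \<union> ord_three) \<union> high_ord)" by (simp add: order_def)
  also have "\<dots> = card (sq_one \<union> ord_three) + card high_ord"
    by (rule card_Un_disjoint) (auto simp: high_ord_def)
  also have "card (sq_one \<union> ord_three) = card sq_one + card ord_three"
    by (rule card_Un_disjoint) (auto simp: sq_one_ord_three)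
  finally show ?thesis by simp
qed

end

section \<open>Left multiplication by an involution\<close>

context group
begin

text \<open>
  For an involution \<open>t\<close> these are the involutions \<open>s \<noteq> t\<close> that satisfy the braid relation
  \<open>t s t = s t s\<close> with \<open>t\<close>.
\<close>

definition braid_mates :: "'a \<Rightarrow> 'a set"
  where "braid_mates t = {s \<in> sq_one. t \<otimes> s \<in> ord_three}"

text \<open>
  For an involution \<open>t\<close>, the condition that \<open>t y\<close> squares to one says that \<open>t\<close> inverts \<open>y\<close>.
\<close>

definition three_not_inverted :: "'a \<Rightarrow> 'a set"
  where "three_not_inverted t = {y \<in> ord_three. t \<otimes> y \<notin> sq_one}"

definition high_not_inverted :: "'a \<Rightarrow> 'a set"
  where "high_not_inverted t = {y \<in> high_ord. t \<otimes> y \<notin> sq_one}"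

definition commuting_conjugates :: "'a \<Rightarrow> 'a set"
  where "commuting_conjugates t = conj_class t \<inter> cent t"

lemma conj_class_sq_one: "t \<in> sq_one \<Longrightarrow> conj_class t \<subseteq> sq_one"
  by (auto simp: conj_class_def conjugate_sq_one)

text \<open>
  The braid relation \<open>t s t = s t s\<close> says that \<open>t s\<close> conjugates \<open>t\<close> to \<open>s\<close>. So an
  involution with a large centralizer, that is with few conjugates, has few braid mates.
\<close>

lemma braid_mates_sub:
  assumes t: "t \<in> sq_one"
  shows "braid_mates t \<subseteq> conj_class t - commuting_conjugates t"
proof
  fix s assume "s \<in> braid_mates t"
  hence s: "s \<in> sq_one" "t \<otimes> s \<in> ord_three" by (auto simp: braid_mates_def)
  have c: "s \<in> carrier G" "t \<in> carrier G" using s t sq_one_sub by auto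
  have "(t \<otimes> s \<otimes> t) \<otimes> (s \<otimes> t \<otimes> s) = \<one>"
    using s c by (simp add: ord_three_def m_assoc)
  hence "t \<otimes> s \<otimes> t = inv (s \<otimes> t \<otimes> s)"
    using c by (metis inv_equality m_closed)
  also have "\<dots> = s \<otimes> (t \<otimes> s)"
    using c s t by (simp add: inv_mult_group sq_one_inv m_assoc)
  finally have "conjugate (t \<otimes> s) t = s" using c by (simp add: conjugate_eq_iff)
  hence "s \<in> conj_class t" using c by (metis conjugate_in_conj_class m_closed)
  moreover have "s \<notin> cent t" using s t sq_one_mult_iff sq_one_ord_three by blast
  ultimately show "s \<in> conj_class t - commuting_conjugates t" by (simp add: commuting_conjugates_def)
qed

text \<open>
  Here \<open>t\<close> and \<open>y\<close> generate a copy of the alternating group on four letters: with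
  \<open>a = y t y\<^sup>-\<^sup>1\<close> and \<open>b = y\<^sup>2 t y\<^sup>-\<^sup>2\<close> one has \<open>t a b = (t y)\<^sup>3 = 1\<close>, so that \<open>t a = b\<^sup>-\<^sup>1\<close> is an
  involution and \<open>a\<close> commutes with \<open>t\<close>.
\<close>

lemma conjugate_commutes_of_ord_three:
  assumes t: "t \<in> sq_one" "t \<noteq> \<one>" and y: "y \<in> ord_three" "t \<otimes> y \<in> ord_three"
  shows "conjugate y t \<in> commuting_conjugates t - {t}"
proof -
  have c: "t \<in> carrier G" "y \<in> carrier G" using t y sq_one_sub ord_three_sub by auto
  \<comment> \<open>since \<open>y\<^sup>3 = 1\<close>\<close>
  have yy: "inv (y \<otimes> y) = y"
    using y c by (intro inv_equality) (auto simp: ord_three_def)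
  define a where "a = conjugate y t"
  define b where "b = conjugate (y \<otimes> y) t"
  have ab: "a \<in> sq_one" "b \<in> sq_one" using t c by (auto simp: a_def b_def conjugate_sq_one)
  hence abc: "a \<in> carrier G" "b \<in> carrier G" using sq_one_sub by auto
  have "t \<otimes> a \<otimes> b = (t \<otimes> y) \<otimes> ((t \<otimes> y) \<otimes> (t \<otimes> y))"
    using c by (simp add: a_def b_def conjugate_def m_assoc yy)
  hence 1: "t \<otimes> a \<otimes> b = \<one>" using y by (simp add: ord_three_def)
  hence "t \<otimes> a = inv b" using c abc by (metis inv_equality m_closed inv_inv)
  hence "t \<otimes> a \<in> sq_one" using ab by (simp add: sq_one_inv)
  hence "a \<in> cent t" using t ab by (simp add: sq_one_mult_iff)
  moreover have "a \<in> conj_class t" using c by (simp add: a_def conjugate_in_conj_class)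
  moreover have "a \<noteq> t"
  proof
    assume at: "a = t"
    hence "b = t" using c by (simp add: b_def a_def conjugate_comp)
    with 1 at t c show False by (simp add: sq_one_def m_assoc)
  qed
  ultimately show ?thesis by (simp add: commuting_conjugates_def a_def)
qed

lemma mult_sq_one_image:
  assumes t: "t \<in> sq_one" and X: "X \<subseteq> carrier G" and Y: "Y \<subseteq> carrier G"
  shows "card {s \<in> X. t \<otimes> s \<in> Y} = card {y \<in> Y. t \<otimes> y \<in> X}"
proof (rule bij_betw_same_card[of "\<lambda>s. t \<otimes> s"])
  show "bij_betw (\<lambda>s. t \<otimes> s) {s \<in> X. t \<otimes> s \<in> Y} {y \<in> Y. t \<otimes> y \<in> X}"
    by (rule bij_betw_byWitness[of _ "\<lambda>s. t \<otimes> s"])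
      (use t X Y in \<open>auto simp: sq_one_cancel subset_iff\<close>)
qed

end

context finite_group
begin

lemma finite_subsets [simp]:
  "finite (braid_mates t)" "finite (three_not_inverted t)" "finite (high_not_inverted t)"
  "finite (commuting_conjugates t)"
  by (auto simp: braid_mates_def three_not_inverted_def high_not_inverted_def commuting_conjugates_def)

text \<open>
  Multiplication by \<open>t\<close> sends a solution \<open>s\<close> of \<open>s\<^sup>2 = 1\<close> to another solution if \<open>s\<close> commutes with
  \<open>t\<close>, to an element of order three if \<open>s\<close> is a braid mate, and otherwise to an element of
  order at least four that \<open>t\<close> inverts.
\<close>

lemma sq_one_count:
  assumes t: "t \<in> sq_one"
  shows "card sq_one + card (high_not_inverted t)
    = card (sq_one \<inter> cent t) + card (braid_mates t) + card high_ord"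
proof -
  have tc: "t \<in> carrier G" using t sq_one_sub by auto
  let ?W = "{s \<in> sq_one. t \<otimes> s \<in> high_ord}"
  have 1: "{s \<in> sq_one. t \<otimes> s \<in> sq_one} = sq_one \<inter> cent t"
    using t sq_one_mult_iff by auto
  have I: "sq_one = (sq_one \<inter> cent t \<union> braid_mates t) \<union> ?W"
    using tc sq_one_sub by (auto simp flip: 1 simp: braid_mates_def high_ord_def)
  have "card sq_one = card (sq_one \<inter> cent t \<union> braid_mates t) + card ?W"
    by (subst I, rule card_Un_disjoint)
      (auto simp flip: 1 simp: braid_mates_def high_ord_def)
  also have "card (sq_one \<inter> cent t \<union> braid_mates t) = card (sq_one \<inter> cent t) + card (braid_mates t)"
    using sq_one_ord_three
    by (intro card_Un_disjoint) (auto simp flip: 1 simp: braid_mates_def)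
  finally have 2: "card sq_one = card (sq_one \<inter> cent t) + card (braid_mates t) + card ?W" .
  have "high_ord = {y \<in> high_ord. t \<otimes> y \<in> sq_one} \<union> high_not_inverted t"
    by (auto simp: high_not_inverted_def)
  hence "card high_ord = card ({y \<in> high_ord. t \<otimes> y \<in> sq_one} \<union> high_not_inverted t)"
    by (rule arg_cong)
  also have "\<dots> = card {y \<in> high_ord. t \<otimes> y \<in> sq_one} + card (high_not_inverted t)"
    by (intro card_Un_disjoint) (auto simp: high_not_inverted_def)
  also have "card {y \<in> high_ord. t \<otimes> y \<in> sq_one} = card ?W"
    by (rule mult_sq_one_image[OF t high_ord_sub sq_one_sub])
  finally show ?thesis using 2 by simp
qed

lemma ord_three_count:
  assumes t: "t \<in> sq_one"
  shows "card ord_three = card (braid_mates t) + card (three_not_inverted t)"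
proof -
  have "ord_three = {y \<in> ord_three. t \<otimes> y \<in> sq_one} \<union> three_not_inverted t"
    by (auto simp: three_not_inverted_def)
  hence "card ord_three = card ({y \<in> ord_three. t \<otimes> y \<in> sq_one} \<union> three_not_inverted t)"
    by (rule arg_cong)
  also have "\<dots> = card {y \<in> ord_three. t \<otimes> y \<in> sq_one} + card (three_not_inverted t)"
    by (intro card_Un_disjoint) (auto simp: three_not_inverted_def)
  also have "card {y \<in> ord_three. t \<otimes> y \<in> sq_one} = card (braid_mates t)"
    unfolding braid_mates_def by (rule mult_sq_one_image[OF t ord_three_sub sq_one_sub])
  finally show ?thesis .
qed

lemma card_class_split:
  assumes t: "t \<in> sq_one"
  shows "card (braid_mates t) + card (commuting_conjugates t) \<le> card (conj_class t)"
proof -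
  have "card (braid_mates t \<union> commuting_conjugates t) = card (braid_mates t) + card (commuting_conjugates t)"
    using braid_mates_sub[OF t] by (intro card_Un_disjoint) auto
  moreover have "card (braid_mates t \<union> commuting_conjugates t) \<le> card (conj_class t)"
    using braid_mates_sub[OF t] by (intro card_mono) (auto simp: commuting_conjugates_def)
  ultimately show ?thesis by simp
qed

lemma self_in_commuting_conjugates: "t \<in> carrier G \<Longrightarrow> t \<in> commuting_conjugates t"
  by (simp add: commuting_conjugates_def self_in_conj_class self_in_cent)

lemma card_commuting_conjugates_pos: "t \<in> carrier G \<Longrightarrow> 1 \<le> card (commuting_conjugates t)"
  using self_in_commuting_conjugates[of t] card_gt_0_iff[of "commuting_conjugates t"] by (auto simp: Suc_le_eq)

text \<open>
  If \<open>t\<close> does not invert the element \<open>y\<close> of order three, then \<open>t y\<close> has order three or at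
  least four. In the first case \<open>y\<close> moves \<open>t\<close> to another conjugate in its centralizer, and each such
  conjugate is reached from one coset of the centralizer only; in the second case \<open>t y\<close> is again not
  inverted by \<open>t\<close>.
\<close>

lemma card_three_not_inverted_le:
  assumes t: "t \<in> sq_one" "t \<noteq> \<one>"
  shows "card (three_not_inverted t)
    \<le> (card (commuting_conjugates t) - 1) * card (cent t) + card (high_not_inverted t)"
proof -
  have tc: "t \<in> carrier G" using t sq_one_sub by auto
  let ?A = "{y \<in> ord_three. t \<otimes> y \<in> ord_three}" and ?B = "{y \<in> ord_three. t \<otimes> y \<in> high_not_inverted t}"
  have "three_not_inverted t \<subseteq> ?A \<union> ?B"
    using tc t ord_three_sub sq_one_cancel[OF t(1) subsetD[OF ord_three_sub]] sq_one_ord_three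
    by (auto simp: three_not_inverted_def high_not_inverted_def high_ord_def)
  hence "card (three_not_inverted t) \<le> card (?A \<union> ?B)" by (intro card_mono) auto
  also have "\<dots> \<le> card ?A + card ?B" by (rule card_Un_le)
  also have "card ?B = card {y \<in> high_not_inverted t. t \<otimes> y \<in> ord_three}"
    using high_ord_sub
    by (intro mult_sq_one_image t ord_three_sub) (auto simp: high_not_inverted_def)
  also have "\<dots> \<le> card (high_not_inverted t)" by (intro card_mono) auto
  also have "card ?A \<le> card (\<Union>s\<in>commuting_conjugates t - {t}. {g \<in> carrier G. conjugate g t = s})"
    using conjugate_commutes_of_ord_three[OF t] ord_three_sub by (intro card_mono) auto
  also have "\<dots> \<le> (\<Sum>s\<in>commuting_conjugates t - {t}. card {g \<in> carrier G. conjugate g t = s})"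
    by (rule card_UN_le) simp
  also have "\<dots> = (\<Sum>s\<in>commuting_conjugates t - {t}. card (cent t))"
    using card_transporter[OF tc] by (intro sum.cong) (auto simp: commuting_conjugates_def)
  also have "\<dots> = (card (commuting_conjugates t) - 1) * card (cent t)"
    using self_in_commuting_conjugates[OF tc] by simp
  finally show ?thesis by simp
qed

lemma even_card_fixpoint_free:
  assumes "finite A" "\<And>x. x \<in> A \<Longrightarrow> f x \<in> A" "\<And>x. x \<in> A \<Longrightarrow> f (f x) = x" "\<And>x. x \<in> A \<Longrightarrow> f x \<noteq> x"
  shows "even (card A)"
  using assms
proof (induction "card A" arbitrary: A rule: less_induct)
  case less
  show ?case
  proof (cases "A = {}")
    case False
    then obtain x where x: "x \<in> A" by blast
    let ?B = "A - {x, f x}"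
    have cB: "card ?B + 2 = card A"
    proof -
      have "card {x, f x} = 2" using less.prems(4)[OF x] by simp
      thus ?thesis
        using x less.prems card_Diff_subset[of "{x, f x}" A] card_mono[of A "{x, f x}"] by simp
    qed
    have "even (card ?B)"
    proof (rule less.hyps)
      show "card ?B < card A" using cB by simp
      show "f y \<in> ?B" if "y \<in> ?B" for y
        using that less.prems(2,3) x by (metis Diff_iff empty_iff insert_iff)
    qed (use less.prems in auto)
    thus ?thesis using cB by presburger
  qed simp
qed

text \<open>
  Conjugation by \<open>t\<close> pairs off the conjugates of \<open>t\<close> that do not commute with it.
\<close>

lemma even_card_noncommuting:
  assumes t: "t \<in> sq_one"
  shows "even (card (conj_class t - commuting_conjugates t))"
proof (rule even_card_fixpoint_free[of _ "conjugate t"])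
  have tc: "t \<in> carrier G" using t sq_one_sub by auto
  fix s assume s: "s \<in> conj_class t - commuting_conjugates t"
  hence sc: "s \<in> carrier G" "s \<notin> cent t" "s \<in> conj_class t"
    using conj_class_sub[OF tc] by (auto simp: commuting_conjugates_def)
  show tt: "conjugate t (conjugate t s) = s"
    using t tc sc by (simp flip: conjugate_comp add: sq_one_def)
  show "conjugate t s \<noteq> s" using sc tc conjugate_self_iff cent_sym by blast
  have "conjugate t s \<notin> cent t"
  proof
    assume "conjugate t s \<in> cent t"
    hence "conjugate t (conjugate t s) = conjugate t s"
      using sc tc conjugate_self_iff cent_sym by (meson conjugate_closed)
    thus False using tt \<open>conjugate t s \<noteq> s\<close> by simp
  qed
  thus "conjugate t s \<in> conj_class t - commuting_conjugates t"
    using conj_class_conj[OF tc tc sc(3)] by (simp add: commuting_conjugates_def)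
qed simp

text \<open>
  Two elements that invert \<open>x\<close> differ by an element of its centralizer.
\<close>

lemma card_inverting_le:
  assumes x: "x \<in> carrier G"
  shows "card {t \<in> sq_one. t \<otimes> x \<in> sq_one} \<le> card (cent x)"
proof (cases "{t \<in> sq_one. t \<otimes> x \<in> sq_one} = {}")
  case False
  then obtain u where u: "u \<in> sq_one" "u \<otimes> x \<in> sq_one" by blast
  have inv: "t \<otimes> x = inv x \<otimes> t" if "t \<in> sq_one" "t \<otimes> x \<in> sq_one" for t
    using that x sq_one_inv[of "t \<otimes> x"] sq_one_inv[of t] sq_one_sub
    by (metis inv_mult_group subsetD)
  have uc: "u \<in> carrier G" using u sq_one_sub by auto
  show ?thesis
  proof (rule card_inj_on_le[of "\<lambda>t. u \<otimes> t"])
    show "inj_on (\<lambda>t. u \<otimes> t) {t \<in> sq_one. t \<otimes> x \<in> sq_one}"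
      using uc sq_one_sub by (intro inj_mult_left) auto
    show "(\<lambda>t. u \<otimes> t) ` {t \<in> sq_one. t \<otimes> x \<in> sq_one} \<subseteq> cent x"
    proof clarify
      fix t assume t: "t \<in> sq_one" "t \<otimes> x \<in> sq_one"
      hence tc: "t \<in> carrier G" using sq_one_sub by auto
      have ux: "u \<otimes> inv x = x \<otimes> u"
        using inv[OF u] uc x by (metis inv_closed inv_solve_left inv_solve_right m_assoc m_closed)
      have "u \<otimes> t \<otimes> x = u \<otimes> (inv x \<otimes> t)" using inv[OF t] uc tc x by (simp add: m_assoc)
      also have "\<dots> = x \<otimes> (u \<otimes> t)" using ux uc tc x by (simp flip: m_assoc)
      finally show "u \<otimes> t \<in> cent x" using uc tc by (simp add: cent_def)
    qed
  qed simp
next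
  case True
  show ?thesis unfolding True by simp
qed

end

section \<open>Subgroups with many involutions, and elements of order three\<close>

context finite_group
begin

lemma subgroup_eq_carrier:
  assumes H: "subgroup H G" and large: "order G < 2 * card H"
  shows "H = carrier G"
proof -
  have eq: "card (rcosets H) * card H = order G" by (rule lagrange[OF H])
  have "card (rcosets H) < 2"
  proof (rule ccontr)
    assume "\<not> card (rcosets H) < 2"
    hence "2 * card H \<le> card (rcosets H) * card H" by (intro mult_right_mono) auto
    thus False using large eq by linarith
  qed
  moreover have "card (rcosets H) \<noteq> 0"
  proof
    assume "card (rcosets H) = 0"
    hence "order G = 0" using eq by simp
    thus False using order_gt_0_iff_finite by simp
  qed
  ultimately have "card (rcosets H) = 1" by linarith
  hence "card H = card (carrier G)" using eq by (simp add: order_def)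
  thus ?thesis by (intro card_subset_eq subgroup.subset[OF H]) auto
qed

text \<open>
  Let \<open>x\<close> square to one. Both \<open>y\<close> and \<open>x y\<close> square to one for more than half of all \<open>y\<close>, and these
  \<open>y\<close> commute with \<open>x\<close>. So every such \<open>x\<close> is central, and the solutions of \<open>x\<^sup>2 = 1\<close> form a
  subgroup of index one.
\<close>

lemma exponent_two_of_many:
  assumes many: "3 * order G < 4 * card sq_one"
  shows "sq_one = carrier G"
proof -
  have central: "cent x = carrier G" if x: "x \<in> sq_one" for x
  proof -
    have xc: "x \<in> carrier G" using x sq_one_sub by auto
    let ?A = "{y \<in> sq_one. x \<otimes> y \<in> sq_one}" and ?B = "{y \<in> sq_one. x \<otimes> y \<notin> sq_one}"
    have "?A \<union> ?B = sq_one" by auto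
    hence "card sq_one \<le> card ?A + card ?B" using card_Un_le[of ?A ?B] by simp
    moreover have "card ?A \<le> card (cent x)"
      using x sq_one_mult_iff by (intro card_mono) auto
    moreover have "card ?B \<le> card (carrier G - sq_one)"
      using xc sq_one_sub by (intro card_inj_on_le[of "\<lambda>y. x \<otimes> y"] inj_mult_left) auto
    moreover have "card (carrier G - sq_one) + card sq_one = order G"
      using card_Diff_subset[OF _ sq_one_sub] card_mono[OF _ sq_one_sub] by (simp add: order_def)
    ultimately have "order G < 2 * card (cent x)" using many by linarith
    thus ?thesis by (rule subgroup_eq_carrier[OF subgroup_cent[OF xc]])
  qed
  have "subgroup sq_one G"
  proof (rule subgroupI)
    show "inv a \<in> sq_one" if "a \<in> sq_one" for a using that by (simp add: sq_one_inv)
    show "a \<otimes> b \<in> sq_one" if "a \<in> sq_one" "b \<in> sq_one" for a b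
      using that central[of a] sq_one_sub by (simp add: sq_one_mult_iff subset_iff)
  qed (use sq_one_sub one_sq_one in blast)+
  thus ?thesis using many by (intro subgroup_eq_carrier) linarith+
qed

lemma three_dvd_order:
  assumes "ord_three \<noteq> {}"
  shows "3 dvd order G"
proof -
  obtain x where x: "x \<in> carrier G" "x \<noteq> \<one>" "x \<otimes> (x \<otimes> x) = \<one>"
    using assms by (auto simp: ord_three_def)
  have "x [^] (3::nat) = \<one>" using x by (simp add: numeral_3_eq_3 m_assoc)
  hence "ord x dvd 3" using x(1) pow_eq_id by simp
  moreover have "ord x \<noteq> 1" using x ord_eq_1 by simp
  moreover have "d \<le> 3 \<Longrightarrow> d dvd 3 \<Longrightarrow> d \<noteq> 1 \<Longrightarrow> d = 3" for d :: nat
    by (cases "d = 0"; cases "d = 2") auto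
  ultimately have "ord x = 3"
    using dvd_imp_le[of "ord x" 3] by simp
  thus ?thesis using ord_dvd_group_order[OF x(1)] by simp
qed

lemma finite_group_subgroup:
  assumes "subgroup H G"
  shows "finite_group (G\<lparr>carrier := H\<rparr>)"
proof -
  interpret H: group "G\<lparr>carrier := H\<rparr>" by (rule subgroup_imp_group[OF assms])
  show ?thesis
    using finite_sub[OF subgroup.subset[OF assms]]
    by (unfold_locales) simp
qed

lemma subgroup_exponent_two:
  assumes H: "subgroup H G" and many: "3 * card H < 4 * card (sq_one \<inter> H)"
  shows "H \<subseteq> sq_one"
proof
  fix x assume x: "x \<in> H"
  interpret H: finite_group "G\<lparr>carrier := H\<rparr>" by (rule finite_group_subgroup[OF H])
  have "H \<subseteq> carrier G" by (rule subgroup.subset[OF H])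
  hence eq: "H.sq_one = sq_one \<inter> H" by (auto simp: H.sq_one_def sq_one_def)
  hence "H.sq_one = H"
    using many H.exponent_two_of_many by (simp add: order_def)
  thus "x \<in> sq_one" using x eq by blast
qed

lemma cauchy_three:
  assumes H: "subgroup H G" and dvd: "card H = 3 * b" "\<not> 3 dvd b"
  obtains K where "subgroup K G" "K \<subseteq> H" "card K = 3"
proof -
  interpret H: finite_group "G\<lparr>carrier := H\<rparr>" by (rule finite_group_subgroup[OF H])
  have "\<exists>K. subgroup K (G\<lparr>carrier := H\<rparr>) \<and> card K = 3 ^ 1"
    using dvd by (intro sylow_thm[of 3 _ 1 b]) (auto simp: order_def finite_sub[OF subgroup.subset[OF H]] intro: H.is_group)
  then obtain K where K: "subgroup K (G\<lparr>carrier := H\<rparr>)" "card K = 3" by auto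
  show ?thesis
    using K incl_subgroup[OF H K(1)] subgroup.subset[OF K(1)] by (intro that[of K]) auto
qed

end

context group
begin

lemma conjugate_cent:
  assumes "g \<in> carrier G" "x \<in> carrier G" "y \<in> cent x"
  shows "conjugate g y \<in> cent (conjugate g x)"
  using assms by (auto simp: cent_def simp flip: conjugate_mult)

end

section \<open>Groups with many involutions and no small conjugacy class\<close>

text \<open>
  The first assumption is what an average order below \<open>11 / 4\<close> says about the numbers of elements
  of the various orders; the second excludes nontrivial conjugacy classes with fewer than five elements.
\<close>

locale many_involutions = finite_group +
  assumes abundant: "order G + 4 * card high_ord < 4 * card sq_one + 4"
    and big_class: "x \<in> carrier G \<Longrightarrow> x \<noteq> \<one> \<Longrightarrow> 5 * card (cent x) \<le> order G"
begin

lemma mates_excess: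
  assumes t: "t \<in> sq_one"
  shows "order G + 4 * card (high_not_inverted t)
    < 4 * card (sq_one \<inter> cent t) + 4 * card (braid_mates t) + 4"
  using sq_one_count[OF t] abundant by presburger

lemma twice_card_sq_one:
  assumes t: "t \<in> sq_one"
  shows "2 * card sq_one + card (three_not_inverted t) + card (high_not_inverted t)
    = order G + card (sq_one \<inter> cent t)"
  using sq_one_count[OF t] ord_three_count[OF t] card_parts by linarith

lemma card_cent_pos: "x \<in> carrier G \<Longrightarrow> 0 < card (cent x)"
  using self_in_cent[of x] by (subst card_gt_0_iff) auto

lemma card_conj_class_ge:
  assumes "x \<in> carrier G" "x \<noteq> \<one>"
  shows "5 \<le> card (conj_class x)"
  using big_class[OF assms] card_conj_class_cent[OF assms(1)] card_cent_pos[OF assms(1)]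
  by (metis mult_le_cancel2)

lemma card_sq_one_cent_le: "card (sq_one \<inter> cent t) \<le> card (cent t)"
  by (intro card_mono) auto

lemma even_card_cent:
  assumes t: "t \<in> sq_one" "t \<noteq> \<one>"
  shows "even (card (cent t))"
proof -
  have tc: "t \<in> carrier G" using t sq_one_sub by auto
  have "subgroup {\<one>, t} G" using t(1) by (rule subgroup_order_two)
  moreover have "{\<one>, t} \<subseteq> cent t" using tc by (auto simp: cent_def)
  ultimately have "card {\<one>, t} dvd card (cent t)"
    using card_subgroup_dvd subgroup_cent[OF tc] by blast
  moreover have "card {\<one>, t} = 2" using t by simp
  ultimately show ?thesis by (simp only:)
qed

lemma card_sq_one_cent_ge:
  assumes t: "t \<in> sq_one" "t \<noteq> \<one>"
  shows "2 \<le> card (sq_one \<inter> cent t)"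
proof -
  have tc: "t \<in> carrier G" using t sq_one_sub by auto
  have "{\<one>, t} \<subseteq> sq_one \<inter> cent t" using t tc by (auto simp: cent_def)
  hence "card {\<one>, t} \<le> card (sq_one \<inter> cent t)" by (intro card_mono) auto
  thus ?thesis using t by simp
qed

text \<open>
  If \<open>t\<close> commutes only with \<open>1\<close> and \<open>t\<close>, its class fills half of the group. For every \<open>s\<close> in
  the class, the products of \<open>s\<close> with the class avoid the class, so they are exactly the other half \<open>M\<close>,
  and \<open>s\<close> inverts \<open>M\<close>. Elements of \<open>M\<close> are products of two such \<open>s\<close>, so \<open>M\<close> is commutative; this
  contradicts the bound on centralizers.
\<close>

lemma cent_not_order_two:
  assumes t: "t \<in> sq_one" "t \<noteq> \<one>"
  shows "card (cent t) \<noteq> 2"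
proof
  assume two: "card (cent t) = 2"
  have tc: "t \<in> carrier G" using t sq_one_sub by auto
  define M where "M = carrier G - conj_class t"
  have n: "2 * card (conj_class t) = order G"
    using card_conj_class_cent[OF tc] two by simp
  have cM: "card M = card (conj_class t)"
    using n card_Diff_subset[OF _ conj_class_sub[OF tc]] by (simp add: M_def order_def)
  have K: "s \<in> sq_one" "s \<noteq> \<one>" "s \<in> carrier G" if "s \<in> conj_class t" for s
    using that t tc sq_one_sub conj_class_sq_one by (auto simp: conj_class_def)
  have cs: "cent s = {\<one>, s}" if s: "s \<in> conj_class t" for s
  proof -
    have "card (cent s) = 2"
      using card_conj_class_cent[OF K(3)[OF s]] conj_class_eq[OF tc s] n card_conj_class_ge[OF tc t(2)]
      by (metis mult.commute mult_cancel2 not_numeral_le_zero)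
    moreover have "{\<one>, s} \<subseteq> cent s" using K[OF s] by (auto simp: cent_def)
    ultimately show ?thesis using K[OF s] by (intro card_subset_eq[symmetric]) auto
  qed
  have sM: "(\<lambda>r. s \<otimes> r) ` conj_class t = M" if s: "s \<in> conj_class t" for s
  proof (rule card_subset_eq)
    show "finite M" by (simp add: M_def)
    show "(\<lambda>r. s \<otimes> r) ` conj_class t \<subseteq> M"
    proof (clarsimp simp: M_def, intro conjI notI)
      fix r assume r: "r \<in> conj_class t"
      show "s \<otimes> r \<in> carrier G" using K(3)[OF r] K(3)[OF s] by simp
      assume sr: "s \<otimes> r \<in> conj_class t"
      hence "r \<in> cent s" using K[OF r] K[OF s] K(1)[OF sr] sq_one_mult_iff by blast
      hence "r = s" using cs[OF s] K[OF r] by auto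
      thus False using K(2)[OF sr] K(1)[OF s] by (simp add: sq_one_def)
    qed
    show "card ((\<lambda>r. s \<otimes> r) ` conj_class t) = card M"
      using cM K(3)[OF s] conj_class_sub[OF tc] by (simp add: card_image inj_mult_left)
  qed
  have inverts: "s \<otimes> x = inv x \<otimes> s" if s: "s \<in> conj_class t" and x: "x \<in> M" for s x
  proof -
    obtain r where r: "r \<in> conj_class t" "x = s \<otimes> r" using sM[OF s] x by blast
    thus ?thesis using K[OF s] K[OF r(1)] by (simp add: inv_mult_group sq_one_inv sq_one_cancel sq_one_cancel_right)
  qed
  have comm: "M \<subseteq> cent x" if x: "x \<in> M" for x
  proof
    fix y assume "y \<in> M"
    then obtain r where r: "r \<in> conj_class t" "y = t \<otimes> r"
      using sM[OF self_in_conj_class[OF tc]] by blast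
    have xc: "x \<in> carrier G" using x by (simp add: M_def)
    have rc: "r \<in> carrier G" using K(3)[OF r(1)] .
    have tx: "t \<otimes> inv x = x \<otimes> t"
      using inverts[OF self_in_conj_class[OF tc] x] tc xc
      by (metis inv_closed inv_solve_left inv_solve_right m_assoc m_closed)
    have "y \<otimes> x = t \<otimes> (inv x \<otimes> r)" using r rc tc xc inverts[OF r(1) x] by (simp add: m_assoc)
    also have "\<dots> = x \<otimes> y" using tx r rc tc xc by (simp flip: m_assoc)
    finally show "y \<in> cent x" using tc rc r(2) by (simp add: cent_def)
  qed
  have "\<not> M \<subseteq> {\<one>}"
  proof
    assume "M \<subseteq> {\<one>}"
    hence "card M \<le> card {\<one>}" by (intro card_mono) auto
    thus False using cM card_conj_class_ge[OF tc t(2)] by simp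
  qed
  then obtain x where x: "x \<in> M" "x \<noteq> \<one>" by blast
  hence "card M \<le> card (cent x)" by (intro card_mono comm) auto
  moreover have "5 * card (cent x) \<le> order G" using x by (intro big_class) (auto simp: M_def)
  ultimately show False using n cM card_conj_class_ge[OF tc t(2)] by linarith
qed

text \<open>
  Otherwise the centralizer of \<open>t\<close> alone would have to contain nearly a quarter of the group, but it
  contains at most a fifth.
\<close>

lemma braid_mates_nonempty:
  assumes t: "t \<in> sq_one" "t \<noteq> \<one>"
  shows "braid_mates t \<noteq> {}"
proof
  assume "braid_mates t = {}"
  hence "order G < 4 * card (sq_one \<inter> cent t) + 4" using mates_excess[OF t(1)] by simp
  moreover have "5 * card (cent t) \<le> order G" using t sq_one_sub by (intro big_class) auto
  moreover have "card (cent t) \<noteq> 0" using card_cent_pos[of t] t sq_one_sub by auto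
  ultimately have "card (cent t) < 4" "card (cent t) \<noteq> 0"
    using card_sq_one_cent_le[of t] by linarith+
  hence "card (cent t) = 2"
    using even_card_cent[OF t] by presburger
  thus False using cent_not_order_two[OF t] by simp
qed

text \<open>
  A second involution \<open>s\<close> commuting with \<open>t\<close> would give the subgroup \<open>{1, t, s, t s}\<close> of order four
  in the centralizer.
\<close>

lemma sq_one_cent_of_not_four_dvd:
  assumes t: "t \<in> sq_one" "t \<noteq> \<one>" and "\<not> 4 dvd card (cent t)"
  shows "card (sq_one \<inter> cent t) \<le> 2"
proof -
  have tc: "t \<in> carrier G" using t sq_one_sub by auto
  have "sq_one \<inter> cent t \<subseteq> {\<one>, t}"
  proof (rule ccontr)
    assume "\<not> sq_one \<inter> cent t \<subseteq> {\<one>, t}"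
    then obtain s where s: "s \<in> sq_one" "s \<in> cent t" "s \<noteq> \<one>" "s \<noteq> t" by blast
    have sc: "s \<in> carrier G" using s sq_one_sub by auto
    have st: "s \<otimes> t = t \<otimes> s" using s by (auto simp: cent_def)
    have ts: "t \<otimes> s \<in> sq_one" using s t sq_one_mult_iff by blast
    have rules: "t \<otimes> (t \<otimes> s) = s" "s \<otimes> (t \<otimes> s) = t" "t \<otimes> s \<otimes> t = s" "t \<otimes> s \<otimes> s = t"
      "t \<otimes> s \<otimes> (t \<otimes> s) = \<one>" "t \<otimes> t = \<one>" "s \<otimes> s = \<one>"
    proof -
      show 1: "t \<otimes> (t \<otimes> s) = s" using t sc by (simp add: sq_one_cancel)
      show "t \<otimes> s \<otimes> s = t" using s tc by (simp add: sq_one_cancel_right)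
      show "t \<otimes> s \<otimes> t = s" using 1 st tc sc by (simp add: m_assoc)
      show "s \<otimes> (t \<otimes> s) = t" using s tc sc by (simp flip: st add: sq_one_cancel)
    qed (use s t ts in \<open>simp_all add: sq_one_def\<close>)
    have "subgroup {\<one>, t, s, t \<otimes> s} G"
    proof (rule subgroupI)
      show "inv a \<in> {\<one>, t, s, t \<otimes> s}" if "a \<in> {\<one>, t, s, t \<otimes> s}" for a
        using that s t ts by (auto simp: sq_one_inv)
      show "a \<otimes> b \<in> {\<one>, t, s, t \<otimes> s}" if "a \<in> {\<one>, t, s, t \<otimes> s}" "b \<in> {\<one>, t, s, t \<otimes> s}" for a b
        using that tc sc by (auto simp: rules st)
    qed (use tc sc in auto)
    moreover have "{\<one>, t, s, t \<otimes> s} \<subseteq> cent t"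
      using subgroup.m_closed[OF subgroup_cent[OF tc] self_in_cent[OF tc] s(2)]
        subgroup.one_closed[OF subgroup_cent[OF tc]] self_in_cent[OF tc] s(2) by simp
    ultimately have "card {\<one>, t, s, t \<otimes> s} dvd card (cent t)"
      using card_subgroup_dvd subgroup_cent[OF tc] by blast
    moreover have "card {\<one>, t, s, t \<otimes> s} = 4"
    proof -
      have "t \<otimes> s \<noteq> \<one>" using rules(1) s(4) tc by (metis r_one)
      moreover have "t \<otimes> s \<noteq> t" using rules(1,6) s(3) by auto
      moreover have "t \<otimes> s \<noteq> s" using rules(4,7) t(2) by auto
      ultimately show ?thesis using s t by (simp add: eq_commute[of \<one>] eq_commute[of t s] eq_commute[of t "t \<otimes> s"] eq_commute[of s "t \<otimes> s"])
    qed
    ultimately show False using assms(3) by (simp only:)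
  qed
  hence "card (sq_one \<inter> cent t) \<le> card {\<one>, t}" by (intro card_mono) auto
  thus ?thesis using t by simp
qed

text \<open>
  A subgroup of order three contributes two elements of the centralizer that do not square to one.
\<close>

lemma sq_one_cent_of_order_twelve:
  assumes t: "t \<in> sq_one" and "card (cent t) = 12"
  shows "card (sq_one \<inter> cent t) \<le> 10"
proof -
  have tc: "t \<in> carrier G" using t sq_one_sub by auto
  obtain K where K: "subgroup K G" "K \<subseteq> cent t" "card K = 3"
    using cauchy_three[of "cent t" 4] assms subgroup_cent[OF tc] by auto
  have "x = \<one>" if x: "x \<in> K" "x \<in> sq_one" for x
  proof (rule ccontr)
    assume "x \<noteq> \<one>"
    hence "card {\<one>, x} = 2" by simp
    moreover have "card {\<one>, x} dvd card K"
      using card_subgroup_dvd[OF subgroup_order_two[OF x(2)] K(1)] subgroup.one_closed[OF K(1)] x by simp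
    ultimately have "2 dvd (3::nat)" using K(3) by (simp only:)
    thus False by simp
  qed
  hence "sq_one \<inter> cent t \<subseteq> cent t - (K - {\<one>})" by auto
  hence "card (sq_one \<inter> cent t) \<le> card (cent t - (K - {\<one>}))" by (intro card_mono) auto
  also have "\<dots> = card (cent t) - card (K - {\<one>})"
    using K finite_subset[OF K(2)] by (intro card_Diff_subset) auto
  also have "card (K - {\<one>}) = 2" using K subgroup.one_closed[OF K(1)] by simp
  finally show ?thesis using assms(2) by simp
qed

text \<open>
  By the counting inequality at least seven of the eight elements of the centralizer square to
  one, so it is elementary abelian, and at most two conjugates of \<open>t\<close> lie in it. The parity of the number of
  the others leaves exactly two, \<open>t\<close> and \<open>s\<close>. An element that conjugates \<open>t\<close> to \<open>s\<close> normalizes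
  the common centralizer of both, so it swaps them and fixes \<open>t s\<close>. This gives \<open>t s\<close> a
  centralizer of order sixteen in a group of order forty-eight, which is too large.
\<close>

lemma no_centralizer_of_order_eight:
  assumes t: "t \<in> sq_one" "t \<noteq> \<one>" and c: "card (cent t) = 8" and m: "card (conj_class t) = 6"
  shows False
proof -
  have tc: "t \<in> carrier G" using t sq_one_sub by auto
  have n: "order G = 48" using card_conj_class_cent[OF tc] c m by simp
  have j: "5 + card (commuting_conjugates t) < card (sq_one \<inter> cent t)"
    using mates_excess[OF t(1)] card_class_split[OF t(1)] n m by linarith
  hence "3 * card (cent t) < 4 * card (sq_one \<inter> cent t)"
    using c card_commuting_conjugates_pos[OF tc] by linarith
  hence elem: "cent t \<subseteq> sq_one" by (rule subgroup_exponent_two[OF subgroup_cent[OF tc]])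
  hence "sq_one \<inter> cent t = cent t" by blast
  hence k2: "card (commuting_conjugates t) \<le> 2" using j c by simp
  have "card (conj_class t - commuting_conjugates t) = card (conj_class t) - card (commuting_conjugates t)"
    by (intro card_Diff_subset) (auto simp: commuting_conjugates_def)
  hence "even (6 - card (commuting_conjugates t))" using even_card_noncommuting[OF t(1)] m by simp
  hence "card (commuting_conjugates t) = 2" using k2 card_commuting_conjugates_pos[OF tc] by (cases "card (commuting_conjugates t) = 1") auto
  hence "card (commuting_conjugates t - {t}) = 1"
    using self_in_commuting_conjugates[OF tc] by simp
  then obtain s where "commuting_conjugates t - {t} = {s}" by (rule card_1_singletonE)
  hence s: "commuting_conjugates t = {t, s}" "s \<noteq> t"
    using self_in_commuting_conjugates[OF tc] by auto
  have sf: "s \<in> conj_class t" "s \<in> cent t" using s by (auto simp: commuting_conjugates_def)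
  have sI: "s \<in> sq_one" using sf elem by blast
  hence sc: "s \<in> carrier G" using sq_one_sub by auto
  have st: "s \<otimes> t = t \<otimes> s" using sf by (auto simp: cent_def)
  have "cent t \<subseteq> cent s"
  proof
    fix x assume x: "x \<in> cent t"
    hence "s \<otimes> x \<in> sq_one"
      using subgroup.m_closed[OF subgroup_cent[OF tc] sf(2)] elem by blast
    thus "x \<in> cent s" using x elem sI sq_one_mult_iff by blast
  qed
  moreover have "card (cent s) = 8"
    using card_conj_class_cent[OF sc] conj_class_eq[OF tc sf(1)] n m by simp
  ultimately have cs: "cent t = cent s" using c by (intro card_subset_eq) auto
  define X where "X = {g \<in> carrier G. conjugate g t = s}"
  have cX: "card X = 8" using card_transporter[OF tc sf(1)] c by (simp add: X_def)
  have disj: "cent t \<inter> X = {}"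
    using conjugate_self_iff[OF _ tc] s(2) by (auto simp: X_def)
  have z: "t \<otimes> s \<in> carrier G" using tc sc by simp
  \<comment> \<open>the elements that conjugate \<open>t\<close> to \<open>s\<close> swap these two\<close>
  have "X \<subseteq> cent (t \<otimes> s)"
  proof
    fix g assume "g \<in> X"
    hence g: "g \<in> carrier G" "conjugate g t = s" by (auto simp: X_def)
    have "conjugate g s \<in> cent t" using conjugate_cent[OF g(1) tc sf(2)] g(2) cs by simp
    hence "conjugate g s \<in> commuting_conjugates t"
      using conj_class_conj[OF g(1) tc sf(1)] by (simp add: commuting_conjugates_def)
    moreover have "conjugate g s \<noteq> s" using g sc tc s(2) by (metis conjugate_inject)
    ultimately have "conjugate g s = t" using s(1) by blast
    hence "conjugate g (t \<otimes> s) = t \<otimes> s" using g tc sc st by (simp add: conjugate_mult)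
    thus "g \<in> cent (t \<otimes> s)" using conjugate_self_iff[OF g(1) z] by simp
  qed
  moreover have "cent t \<subseteq> cent (t \<otimes> s)"
    using cent_mult_base[OF tc sc] cs by blast
  ultimately have "card (cent t \<union> X) \<le> card (cent (t \<otimes> s))" by (intro card_mono) auto
  moreover have "card (cent t \<union> X) = 16"
    using card_Un_disjoint[OF _ _ disj] c cX by (simp add: X_def)
  moreover have "t \<otimes> s \<noteq> \<one>"
    using s(2) tc sc t(1) sq_one_cancel[OF t(1) sc] by force
  ultimately show False using big_class[OF z] n by simp
qed

text \<open>
  Let \<open>t\<close> have \<open>m\<close> conjugates and commute with \<open>c\<close> elements, \<open>j\<close> of which square to one. The counting
  inequality gives \<open>m c < 4 j + 4 m\<close>. If four does not divide \<open>c\<close>, then \<open>j \<le> 2\<close>, and \<open>m \<ge> 5\<close> is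
  violated. Otherwise \<open>j \<le> c\<close> turns the inequality into \<open>(m - 4) (c - 4) < 16\<close>. As \<open>3\<close> divides \<open>m c\<close>,
  only \<open>(m, c) = (6, 8)\<close> and \<open>(5, 12)\<close> remain besides \<open>c = 4\<close>.
\<close>

lemma card_cent_involution:
  assumes t: "t \<in> sq_one" "t \<noteq> \<one>"
  shows "card (cent t) = 4"
proof (rule ccontr)
  assume ne: "card (cent t) \<noteq> 4"
  define m c j where "m = card (conj_class t)" and "c = card (cent t)"
    and "j = card (sq_one \<inter> cent t)"
  note defs = m_def c_def j_def
  have tc: "t \<in> carrier G" using t sq_one_sub by auto
  have n: "order G = m * c" using card_conj_class_cent[OF tc] by (simp add: defs)
  have m5: "5 \<le> m" using card_conj_class_ge[OF tc t(2)] by (simp add: defs)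
  have jc: "j \<le> c" using card_sq_one_cent_le[of t] by (simp add: defs)
  have lt: "m * c + 4 * card (commuting_conjugates t) < 4 * j + 4 * m + 4"
    using mates_excess[OF t(1)] card_class_split[OF t(1)] n
    by (simp add: defs)
  hence lt': "m * c < 4 * j + 4 * m" using card_commuting_conjugates_pos[OF tc] by linarith
  have ev: "even c" "c \<noteq> 2" "c \<noteq> 0" "c \<noteq> 4"
    using even_card_cent[OF t] cent_not_order_two[OF t] card_cent_pos[OF tc] ne by (auto simp: defs)
  have "4 dvd c"
  proof (rule ccontr)
    assume "\<not> 4 dvd c"
    hence "j \<le> 2" using sq_one_cent_of_not_four_dvd[OF t] by (simp add: defs)
    moreover have "6 \<le> c" using ev by presburger
    hence "m * 6 \<le> m * c" by (intro mult_left_mono) auto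
    ultimately show False using lt' m5 by linarith
  qed
  hence "8 \<le> c" using ev by presburger
  \<comment> \<open>with \<open>m = 5 + a\<close> this turns the product inequality into one between natural numbers without subtraction\<close>
  then obtain b where b: "c = 8 + b" using le_Suc_ex by blast
  obtain a where a: "m = 5 + a" using m5 le_Suc_ex by blast
  have ab: "4 * a + b + a * b < 12" using lt' jc a b by (simp add: algebra_simps)
  have "ord_three \<noteq> {}" using braid_mates_nonempty[OF t] by (auto simp: braid_mates_def)
  hence three: "3 dvd m * c" using three_dvd_order n by simp
  have "4 dvd b" using \<open>4 dvd c\<close> b by presburger
  moreover have "b < 12" using ab by linarith
  ultimately have "b = 0 \<or> b = 4 \<or> b = 8" by presburger
  moreover have "a \<in> {0, 1, 2}" using ab by auto
  ultimately have "c = 8 \<and> m = 6 \<or> c = 12 \<and> m = 5"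
    using ab three a b by auto
  thus False
  proof
    assume "c = 8 \<and> m = 6"
    thus False using no_centralizer_of_order_eight[OF t] by (simp add: defs)
  next
    assume *: "c = 12 \<and> m = 5"
    hence "j \<le> 10" using sq_one_cent_of_order_twelve[OF t(1)] by (simp add: defs)
    thus False using lt * card_commuting_conjugates_pos[OF tc] by simp
  qed
qed

lemma card_involutions:
  assumes t: "t \<in> sq_one" "t \<noteq> \<one>"
  shows "\<exists>l. card sq_one = 1 + l * card (conj_class t)"
proof -
  let ?m = "card (conj_class t)" and ?C = "conj_class ` (sq_one - {\<one>})"
  have U: "\<Union>?C = sq_one - {\<one>}"
  proof (intro equalityI subsetI)
    fix x assume "x \<in> \<Union>?C"
    then obtain s where "s \<in> sq_one" "s \<noteq> \<one>" "x \<in> conj_class s" by blast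
    thus "x \<in> sq_one - {\<one>}"
      using sq_one_sub conjugate_sq_one by (auto simp: conj_class_def subset_iff)
  next
    fix x assume "x \<in> sq_one - {\<one>}"
    thus "x \<in> \<Union>?C" using self_in_conj_class[of x] sq_one_sub by auto
  qed
  have "?m * card ?C = card (\<Union>?C)"
  proof (rule card_partition)
    show "finite ?C" "finite (\<Union>?C)" by simp_all
    show "card K = ?m" if "K \<in> ?C" for K
    proof -
      obtain s where s: "s \<in> sq_one" "s \<noteq> \<one>" "K = conj_class s" using \<open>K \<in> ?C\<close> by blast
      have "s \<in> carrier G" "t \<in> carrier G" using s t sq_one_sub by auto
      hence "card (conj_class s) * 4 = card (conj_class t) * 4"
        using card_conj_class_cent[of s] card_conj_class_cent[of t]
          card_cent_involution[OF s(1,2)] card_cent_involution[OF t] by simp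
      thus ?thesis using s(3) by simp
    qed
    show "K \<inter> L = {}" if KL: "K \<in> ?C" "L \<in> ?C" "K \<noteq> L" for K L
    proof (rule ccontr)
      assume "K \<inter> L \<noteq> {}"
      then obtain x where x: "x \<in> K" "x \<in> L" by blast
      obtain r where r: "K = conj_class r" "r \<in> sq_one - {\<one>}" using KL(1) by (rule imageE)
      obtain s where s: "L = conj_class s" "s \<in> sq_one - {\<one>}" using KL(2) by (rule imageE)
      have rs: "r \<in> carrier G" "s \<in> carrier G" using r(2) s(2) sq_one_sub by auto
      have "conj_class x = conj_class r" using rs(1) x(1)[unfolded r(1)] by (rule conj_class_eq)
      moreover have "conj_class x = conj_class s" using rs(2) x(2)[unfolded s(1)] by (rule conj_class_eq)
      ultimately have "K = L" using r(1) s(1) by (simp only:)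
      thus False using KL(3) by simp
    qed
  qed
  hence "card (sq_one - {\<one>}) = card ?C * ?m" using U by (simp add: mult.commute)
  moreover have "card sq_one = 1 + card (sq_one - {\<one>})"
    using card.remove[of sq_one \<one>] by simp
  ultimately show ?thesis by metis
qed

text \<open>
  Every class of involutions has \<open>m = n / 4\<close> elements, so \<open>i = 1 + l m\<close> for some \<open>l\<close>. The two ways of
  counting along \<open>t\<close> give \<open>2 m - 3 \<le> i \<le> 2 m + 2\<close>, so that \<open>l = 2\<close>. With this value the count of all
  elements leaves room for at most two elements of order three that \<open>t\<close> does not invert.
\<close>

lemma half_involutions:
  assumes t: "t \<in> sq_one" "t \<noteq> \<one>"
  shows "2 * card sq_one = order G + 2" "card (three_not_inverted t) \<le> 2"
proof -
  define m j k T R where "m = card (conj_class t)" and "j = card (sq_one \<inter> cent t)"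
    and "k = card (commuting_conjugates t)" and "T = card (three_not_inverted t)" and "R = card (high_not_inverted t)"
  note defs = m_def j_def k_def T_def R_def
  have tc: "t \<in> carrier G" using t sq_one_sub by auto
  have c: "card (cent t) = 4" by (rule card_cent_involution[OF t])
  have n: "order G = 4 * m" using card_conj_class_cent[OF tc] c by (simp add: defs)
  have m5: "5 \<le> m" using card_conj_class_ge[OF tc t(2)] by (simp add: defs)
  have j4: "j \<le> 4" using card_sq_one_cent_le[of t] c by (simp add: defs)
  have "commuting_conjugates t \<subseteq> sq_one \<inter> cent t - {\<one>}"
    using conj_class_sq_one[OF t(1)] t(2) tc by (auto simp: commuting_conjugates_def conj_class_def)
  hence "k \<le> card (sq_one \<inter> cent t - {\<one>})" unfolding k_def by (intro card_mono) auto
  moreover have "\<one> \<in> cent t" using tc by (simp add: cent_def)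
  hence "card (sq_one \<inter> cent t - {\<one>}) = j - 1"
    by (simp add: j_def card_Diff_singleton)
  ultimately have kj: "k + 1 \<le> j"
    using card_sq_one_cent_ge[OF t] by (simp add: j_def)
  have k1: "1 \<le> k" using card_commuting_conjugates_pos[OF tc] by (simp add: defs)
  have T: "T \<le> (k - 1) * 4 + R" using card_three_not_inverted_le[OF t] c by (simp add: defs)
  have R: "R + k \<le> j"
    using mates_excess[OF t(1)] card_class_split[OF t(1)] n by (simp add: defs)
  have I: "2 * card sq_one + T + R = 4 * m + j"
    using twice_card_sq_one[OF t(1)] n by (simp add: defs)
  obtain l where l: "card sq_one = 1 + l * m" using card_involutions[OF t] by (auto simp: defs)
  have "T + 4 \<le> 4 * k + R" using T k1 by simp
  hence "4 * m \<le> 2 * card sq_one + 6" using I R j4 kj by linarith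
  hence "4 * m \<le> 2 * (l * m) + 8" using l by simp
  hence "l \<noteq> 0" "l \<noteq> 1" using m5 by (cases "l = 0"; cases "l = 1"; simp)+
  moreover have "l < 3"
  proof (rule ccontr)
    assume "\<not> l < 3"
    hence "3 * m \<le> l * m" by (intro mult_right_mono) auto
    thus False using I l j4 m5 by linarith
  qed
  ultimately have "l = 2" by linarith
  hence I': "card sq_one = 1 + 2 * m" using l by simp
  show "2 * card sq_one = order G + 2" using I' n by linarith
  have "T \<le> 2" using I I' j4 by linarith
  thus "card (three_not_inverted t) \<le> 2" by (simp only: T_def)
qed

text \<open>
  Without involutions the first assumption bounds the order by seven, the second one from below by
  ten. Otherwise the pairs of an involution \<open>s\<close> and an element \<open>x\<close> of order three not inverted by \<open>s\<close> are
  counted twice: there are at most two \<open>x\<close> for each \<open>s\<close>, but for each \<open>x\<close> at least three fifths of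
  the involutions occur, and there are at least five \<open>x\<close>.
\<close>

theorem order_eq_one: "order G = 1"
proof (rule ccontr)
  assume n1: "order G \<noteq> 1"
  show False
  proof (cases "sq_one = {\<one>}")
    case True
    have "order G < 8" using abundant by (simp add: True)
    have "card (carrier G) \<noteq> 1" using n1 by (simp add: order_def)
    hence "carrier G \<noteq> {\<one>}" by auto
    then obtain x where x: "x \<in> carrier G" "x \<noteq> \<one>" by blast
    have "{\<one>, x} \<subseteq> cent x" using x by (auto simp: cent_def)
    hence "card {\<one>, x} \<le> card (cent x)" by (intro card_mono) auto
    hence "2 \<le> card (cent x)" using x by simp
    thus False using big_class[OF x] \<open>order G < 8\<close> by linarith
  next
    case False
    then obtain t where t: "t \<in> sq_one" "t \<noteq> \<one>" using one_sq_one by blast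
    \<comment> \<open>\<open>m\<close> is the number of all involutions\<close>
    define m where "m = card sq_one - 1"
    have n: "order G = 2 * m" and cI: "card (sq_one - {\<one>}) = m"
      using half_involutions(1)[OF t] by (simp_all add: m_def)
    have "0 < order G" by (simp add: order_gt_0_iff_finite)
    hence m0: "0 < m" using n by simp
    have x: "6 * m \<le> 10 * card {s \<in> sq_one - {\<one>}. s \<otimes> x \<notin> sq_one}" if x: "x \<in> ord_three" for x
    proof -
      have xc: "x \<in> carrier G" "x \<noteq> \<one>" using x by (auto simp: ord_three_def)
      let ?A = "{s \<in> sq_one - {\<one>}. s \<otimes> x \<notin> sq_one}" and ?B = "{s \<in> sq_one. s \<otimes> x \<in> sq_one}"
      have "sq_one - {\<one>} \<subseteq> ?A \<union> ?B" by auto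
      hence "m \<le> card (?A \<union> ?B)" unfolding cI[symmetric] by (intro card_mono) auto
      also have "\<dots> \<le> card ?A + card ?B" by (rule card_Un_le)
      also have "card ?B \<le> card (cent x)" by (rule card_inverting_le[OF xc(1)])
      finally have "m \<le> card ?A + card (cent x)" by simp
      thus ?thesis using big_class[OF xc] n by linarith
    qed
    have "6 * m * card ord_three \<le> (\<Sum>x\<in>ord_three. 10 * card {s \<in> sq_one - {\<one>}. s \<otimes> x \<notin> sq_one})"
      using sum_bounded_below[of ord_three "6 * m"] x by (simp add: mult.commute)
    also have "\<dots> = 10 * (\<Sum>x\<in>ord_three. \<Sum>s\<in>{s \<in> sq_one - {\<one>}. s \<otimes> x \<notin> sq_one}. 1)"
      by (simp add: sum_distrib_left)
    also have "(\<Sum>x\<in>ord_three. \<Sum>s\<in>{s \<in> sq_one - {\<one>}. s \<otimes> x \<notin> sq_one}. 1)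
        = (\<Sum>s\<in>sq_one - {\<one>}. \<Sum>x\<in>{x \<in> ord_three. s \<otimes> x \<notin> sq_one}. (1::nat))"
      by (rule sum.swap_restrict) auto
    also have "\<dots> = (\<Sum>s\<in>sq_one - {\<one>}. card (three_not_inverted s))"
      by (simp add: three_not_inverted_def)
    also have "\<dots> \<le> (\<Sum>s\<in>sq_one - {\<one>}. 2)"
      using half_involutions(2) by (intro sum_mono) auto
    also have "\<dots> = 2 * m" using cI by simp
    finally have "6 * m * card ord_three \<le> 20 * m" by simp
    hence "card ord_three \<le> 3" using m0 by simp
    moreover obtain x where x: "x \<in> ord_three"
      using braid_mates_nonempty[OF t] by (auto simp: braid_mates_def)
    have "conj_class x \<subseteq> ord_three" using x conjugate_ord_three by (auto simp: conj_class_def)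
    hence "card (conj_class x) \<le> card ord_three" by (intro card_mono) auto
    moreover have "5 \<le> card (conj_class x)"
      using x by (intro card_conj_class_ge) (auto simp: ord_three_def)
    ultimately show False by linarith
  qed
qed

end

section \<open>Sums of element orders\<close>

context finite_group
begin

lemma ord_pos: "x \<in> carrier G \<Longrightarrow> 1 \<le> ord x"
  using ord_ge_1 by simp

lemma psi_lower_bound: "3 * order G + card high_ord \<le> psi G + card sq_one + 1"
proof -
  have ne1: "ord x \<noteq> 1" if "x \<in> carrier G" "x \<noteq> \<one>" for x
    using that ord_eq_1 by simp
  have two: "x \<in> sq_one" if "x \<in> carrier G" "ord x = 2" for x
    using that pow_ord_eq_1[of x] by (simp add: sq_one_def numeral_2_eq_2)
  have three: "x \<in> ord_three" if "x \<in> carrier G" "ord x = 3" for x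
    using that pow_ord_eq_1[of x] by (auto simp: ord_three_def numeral_3_eq_3 m_assoc)
  have I: "2 \<le> ord x" if "x \<in> sq_one - {\<one>}" for x
    using that ne1[of x] ord_pos[of x] sq_one_sub by fastforce
  have T: "3 \<le> ord x" if x: "x \<in> ord_three" for x
    using ne1[of x] ord_pos[of x] two[of x] x sq_one_ord_three ord_three_sub
    by (fastforce simp: ord_three_def)
  have R: "4 \<le> ord x" if x: "x \<in> high_ord" for x
    using ne1[of x] ord_pos[of x] two[of x] three[of x] x by (force simp: high_ord_def)
  have "carrier G = sq_one \<union> ord_three \<union> high_ord"
    using sq_one_sub ord_three_sub by (auto simp: high_ord_def)
  hence "psi G = sum ord (sq_one \<union> ord_three \<union> high_ord)" by (simp add: psi_def)
  also have "\<dots> = sum ord sq_one + sum ord ord_three + sum ord high_ord"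
    using sq_one_ord_three by (subst sum.union_disjoint; auto simp: high_ord_def sum.union_disjoint)
  also have "sum ord sq_one = 1 + sum ord (sq_one - {\<one>})"
    by (subst sum.remove[of sq_one \<one>]) simp_all
  finally have psi: "psi G = 1 + sum ord (sq_one - {\<one>}) + sum ord ord_three + sum ord high_ord" .
  have "card (sq_one - {\<one>}) * 2 \<le> sum ord (sq_one - {\<one>})"
    using sum_bounded_below[of "sq_one - {\<one>}" 2 ord] I by simp
  moreover have "card (sq_one - {\<one>}) = card sq_one - 1" by (simp add: card_Diff_singleton)
  moreover have "card ord_three * 3 \<le> sum ord ord_three"
    using sum_bounded_below[of ord_three 3 ord] T by simp
  moreover have "card high_ord * 4 \<le> sum ord high_ord"
    using sum_bounded_below[of high_ord 4 ord] R by simp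
  moreover have "0 < card sq_one" using one_sq_one by (subst card_gt_0_iff) (blast intro: finite_parts)
  ultimately show ?thesis using psi card_parts by linarith
qed

lemma card_ord_three_ge:
  assumes "ord_three \<noteq> {}"
  shows "2 \<le> card ord_three"
proof -
  obtain x where x: "x \<in> carrier G" "x \<noteq> \<one>" "x \<otimes> (x \<otimes> x) = \<one>"
    using assms by (auto simp: ord_three_def)
  have "inv x = x \<otimes> x" using x by (intro inv_equality) (auto simp: m_assoc)
  hence ne: "x \<otimes> x \<noteq> \<one>" using x by (metis inv_one inv_inv)
  have "x \<noteq> x \<otimes> x"
  proof
    assume "x = x \<otimes> x"
    hence "inv x \<otimes> x = inv x \<otimes> (x \<otimes> x)" by simp
    hence "x = \<one>" using x(1) by simp
    thus False using x by simp
  qed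
  moreover have "{x, x \<otimes> x} \<subseteq> ord_three" using x ne by (auto simp: ord_three_def m_assoc)
  hence "card {x, x \<otimes> x} \<le> card ord_three" by (intro card_mono) auto
  ultimately show ?thesis by simp
qed

text \<open>
  Unless more than three quarters of the elements square to one, the order is below twelve and no
  element has order four or more. An element of order three then forces the order to be \<open>3\<close>, \<open>6\<close> or \<open>9\<close>,
  and in none of these cases the number \<open>i\<close> of solutions of \<open>x\<^sup>2 = 1\<close> fits its bounds.
\<close>

lemma exponent_two_of_small_psi:
  assumes "6 * psi G < 13 * order G" and "x \<in> carrier G"
  shows "x \<otimes> x = \<one>"
proof (cases "3 * order G < 4 * card sq_one")
  case True
  thus ?thesis using exponent_two_of_many assms(2) sq_one_def by blast
next
  case False
  have lower: "5 * order G + 6 * card high_ord < 6 * card sq_one + 6"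
    using psi_lower_bound assms(1) by linarith
  hence high: "card high_ord = 0" and n: "order G < 12" using False by linarith+
  show ?thesis
  proof (cases "ord_three = {}")
    case True
    hence "card sq_one = card (carrier G)" using high card_parts by (simp add: order_def)
    hence "sq_one = carrier G" by (intro card_subset_eq sq_one_sub) auto
    thus ?thesis using assms(2) by (auto simp: sq_one_def)
  next
    case ne: False
    define i where "i = card sq_one"
    obtain q where q: "order G = 3 * q" using three_dvd_order[OF ne] by blast
    have "i + 2 \<le> 3 * q" using card_ord_three_ge[OF ne] card_parts q by (simp add: i_def)
    moreover have i: "5 * q \<le> 2 * i + 1" "4 * i \<le> 9 * q"
      using lower False q unfolding i_def by linarith+
    moreover have "q = 0 \<or> q = 1 \<or> q = 2 \<or> q = 3" using n q by linarith
    moreover have "q \<noteq> 2"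
    proof
      assume "q = 2"
      moreover from this have "5 \<le> i" using i by linarith
      ultimately show False using i by linarith
    qed
    ultimately have False by (elim disjE) simp_all
    thus ?thesis ..
  qed
qed

text \<open>
  The order of a coset divides the order of each of its elements.
\<close>

lemma psi_quotient_le:
  assumes N: "N \<lhd> G"
  shows "psi (G Mod N) * card N \<le> psi G"
proof -
  interpret N: normal N G by fact
  interpret Q: group "G Mod N" by (rule N.factorgroup_is_group)
  interpret q: group_hom G "G Mod N" "\<lambda>x. N #> x"
    using N.r_coset_hom_Mod by (simp add: group_hom_def group_hom_axioms_def is_group Q.is_group)
  have carr: "carrier (G Mod N) = (\<lambda>x. N #> x) ` carrier G"
    by (auto simp: FactGroup_def RCOSETS_def)
  have le: "Q.ord (N #> x) \<le> ord x" if x: "x \<in> carrier G" for x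
  proof (rule dvd_imp_le)
    have "(N #> x) [^]\<^bsub>G Mod N\<^esub> ord x = \<one>\<^bsub>G Mod N\<^esub>"
      using q.hom_nat_pow[OF x, of "ord x"] x by simp
    thus "Q.ord (N #> x) dvd ord x" using Q.pow_eq_id x by simp
    show "0 < ord x" using ord_pos[OF x] by simp
  qed
  have fibre: "card {x \<in> carrier G. N #> x = K} = card N" if K: "K \<in> carrier (G Mod N)" for K
  proof -
    have Kr: "K \<in> rcosets N" using K by (simp add: FactGroup_def)
    have "{x \<in> carrier G. N #> x = K} = K"
    proof (intro equalityI subsetI)
      fix x assume "x \<in> {x \<in> carrier G. N #> x = K}"
      thus "x \<in> K" using rcos_self N.subgroup_axioms by blast
    next
      fix x assume x: "x \<in> K"
      obtain y where y: "y \<in> carrier G" "K = N #> y" using Kr by (auto simp: RCOSETS_def)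
      hence "x \<in> carrier G" using x r_coset_subset_G[OF N.subset] by blast
      moreover have "K = N #> x"
        using repr_independence[OF _ y(1) N.subgroup_axioms] x y(2) by blast
      ultimately show "x \<in> {x \<in> carrier G. N #> x = K}" by simp
    qed
    thus ?thesis using card_rcosets_equal[OF Kr] N.subset by simp
  qed
  have "psi (G Mod N) * card N = (\<Sum>K\<in>carrier (G Mod N). \<Sum>x\<in>{x \<in> carrier G. N #> x = K}. Q.ord K)"
    by (simp add: psi_def sum_distrib_left fibre mult.commute[of _ "card N"])
  also have "\<dots> = (\<Sum>K\<in>carrier (G Mod N). \<Sum>x\<in>{x \<in> carrier G. N #> x = K}. Q.ord (N #> x))"
    by (intro sum.cong) auto
  also have "\<dots> = (\<Sum>x\<in>carrier G. Q.ord (N #> x))"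
    unfolding carr by (rule sum.image_gen[symmetric]) simp
  also have "\<dots> \<le> (\<Sum>x\<in>carrier G. ord x)" using le by (intro sum_mono) auto
  finally show ?thesis by (simp add: psi_def)
qed

end

section \<open>Groups of exponent two\<close>

text \<open>
  A homomorphism from a power of the group of order two that is injective, with the exponent as large
  as possible, is onto: an element \<open>g\<close> outside its image would serve as the image of one more generator.
\<close>

lemma exponent_two_elementary:
  fixes G :: "('a, 'b) monoid_scheme" (structure)
  assumes "group G" and fin: "finite (carrier G)"
    and sq: "\<And>x. x \<in> carrier G \<Longrightarrow> x \<otimes> x = \<one>"
  shows "elementary_abelian_2_group G"
proof -
  interpret group G by fact
  have inv: "inv x = x" if "x \<in> carrier G" for x
    using that sq by (intro inv_equality) auto
  have comm: "x \<otimes> y = y \<otimes> x" if "x \<in> carrier G" "y \<in> carrier G" for x y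
    using that inv[of "x \<otimes> y"] inv[of x] inv[of y] by (simp add: inv_mult_group)
  define E where "E m = product_group {..<m} (\<lambda>_. integer_mod_group 2)" for m :: nat
  have E: "group (E m)" for m by (simp add: E_def)
  have carrier_E: "carrier (E m) = ({..<m} \<rightarrow>\<^sub>E {0, 1})" for m
  proof -
    have "{0..<2} = {0, 1 :: int}" by auto
    thus ?thesis by (simp add: E_def carrier_integer_mod_group)
  qed
  have mult_E: "p \<otimes>\<^bsub>E m\<^esub> q = (\<lambda>i\<in>{..<m}. (p i + q i) mod 2)" for m p q
    by (simp add: E_def)
  have one_E: "\<one>\<^bsub>E m\<^esub> = (\<lambda>i\<in>{..<m}. 0)" for m by (simp add: E_def)
  define P where "P m \<longleftrightarrow> (\<exists>h. h \<in> hom (E m) G \<and> inj_on h (carrier (E m)))" for m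
  have P0: "P 0"
    unfolding P_def by (intro exI[of _ "\<lambda>_. \<one>"]) (auto simp: hom_def carrier_E)
  have bound: "m \<le> card (carrier G)" if Pm: "P m" for m
  proof -
    obtain h where h: "h \<in> hom (E m) G" "inj_on h (carrier (E m))" using Pm P_def by blast
    have "card (carrier (E m)) \<le> card (carrier G)"
      using h fin by (intro card_inj_on_le[of h]) (auto simp: hom_def)
    moreover have "card (carrier (E m)) = 2 ^ m"
      by (simp add: carrier_E card_PiE numeral_2_eq_2)
    moreover have "m < 2 ^ m" by (rule less_exp)
    ultimately show ?thesis by linarith
  qed
  obtain m where Pm: "P m" and max: "\<And>k. P k \<Longrightarrow> k \<le> m"
    using ex_has_greatest_nat[of P 0 id "card (carrier G) + 1"] P0 bound by fastforce
  obtain h where h: "h \<in> hom (E m) G" "inj_on h (carrier (E m))" using Pm P_def by blast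
  interpret h: group_hom "E m" G h using E h by (simp add: group_hom_def group_hom_axioms_def is_group)
  have "h ` carrier (E m) = carrier G"
  proof (rule ccontr)
    assume "h ` carrier (E m) \<noteq> carrier G"
    then obtain g where g: "g \<in> carrier G" "g \<notin> h ` carrier (E m)"
      using h by (auto simp: hom_def)
    define e where "e v = (if v = 0 then \<one> else g)" for v :: int
    define h' where "h' p = h (restrict p {..<m}) \<otimes> e (p m)" for p
    have ec: "e v \<in> carrier G" for v using g by (simp add: e_def)
    have restr: "restrict p {..<m} \<in> carrier (E m)" if "p \<in> carrier (E (Suc m))" for p
      using that unfolding carrier_E restrict_PiE_iff by (meson PiE_mem lessThan_iff less_SucI)
    have last: "p m \<in> {0, 1}" if "p \<in> carrier (E (Suc m))" for p
      using that unfolding carrier_E by (meson PiE_mem lessThan_iff lessI)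
    have hom: "h' \<in> hom (E (Suc m)) G"
    proof (rule homI)
      show "h' p \<in> carrier G" if "p \<in> carrier (E (Suc m))" for p
        using restr[OF that] ec by (simp add: h'_def)
      show "h' (p \<otimes>\<^bsub>E (Suc m)\<^esub> q) = h' p \<otimes> h' q"
        if p: "p \<in> carrier (E (Suc m))" and q: "q \<in> carrier (E (Suc m))" for p q
      proof -
        have "restrict (p \<otimes>\<^bsub>E (Suc m)\<^esub> q) {..<m} = restrict p {..<m} \<otimes>\<^bsub>E m\<^esub> restrict q {..<m}"
          by (auto simp: mult_E)
        moreover have "e ((p \<otimes>\<^bsub>E (Suc m)\<^esub> q) m) = e (p m) \<otimes> e (q m)"
          using last[OF p] last[OF q] g sq by (auto simp: mult_E e_def)
        ultimately have "h' (p \<otimes>\<^bsub>E (Suc m)\<^esub> q)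
            = h (restrict p {..<m}) \<otimes> h (restrict q {..<m}) \<otimes> (e (p m) \<otimes> e (q m))"
          using restr[OF p] restr[OF q] by (simp add: h'_def)
        also have "\<dots> = h' p \<otimes> h' q"
          using restr[OF p] restr[OF q] ec comm unfolding h'_def
          by (metis h.hom_closed m_assoc m_closed)
        finally show ?thesis .
      qed
    qed
    interpret h': group_hom "E (Suc m)" G h'
      using E hom by (simp add: group_hom_def group_hom_axioms_def is_group)
    have "inj_on h' (carrier (E (Suc m)))"
      unfolding h'.inj_on_one_iff
    proof (intro allI impI)
      fix p assume p: "p \<in> carrier (E (Suc m))" and one: "h' p = \<one>"
      have "p m \<noteq> 1"
      proof
        assume "p m = 1"
        hence "h (restrict p {..<m}) \<otimes> g = \<one>" using one by (simp add: h'_def e_def)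
        hence "g = h (restrict p {..<m})"
          using inv restr[OF p] g by (metis h.hom_closed inv_equality)
        thus False using g restr[OF p] by blast
      qed
      hence pm: "p m = 0" using last[OF p] by simp
      hence "h (restrict p {..<m}) = \<one>" using one restr[OF p] by (simp add: h'_def e_def)
      hence "restrict p {..<m} = \<one>\<^bsub>E m\<^esub>" using h(2) restr[OF p] h.inj_on_one_iff by blast
      hence *: "p i = 0" if "i < m" for i using that by (metis lessThan_iff one_E restrict_apply')
      show "p = \<one>\<^bsub>E (Suc m)\<^esub>"
      proof
        fix i show "p i = \<one>\<^bsub>E (Suc m)\<^esub> i"
        proof (cases "i < Suc m")
          case True thus ?thesis using * pm by (auto simp: one_E less_Suc_eq)
        next
          case False thus ?thesis using p using PiE_arb[OF p[unfolded carrier_E], of i] by (simp add: one_E)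
        qed
      qed
    qed
    hence "P (Suc m)" using hom P_def by blast
    thus False using max by fastforce
  qed
  hence "h \<in> iso (E m) G" using h by (simp add: iso_def bij_betw_def)
  hence "G \<cong> E m" using group.iso_sym[OF E] by (auto simp: is_iso_def)
  thus ?thesis unfolding elementary_abelian_2_group_def E_def by blast
qed

section \<open>Small conjugacy classes and the symmetric group on four letters\<close>

text \<open>
  That the symmetric group on four letters has trivial third derived subgroup is verified by
  computation. For this a permutation of \<open>1, 2, 3, 4\<close> is represented by the list of its values. The chain
  of subgroups is the familiar one: symmetric group, alternating group, Klein four-group, trivial group.
\<close>

definition perm_word :: "(nat \<Rightarrow> nat) \<Rightarrow> nat list"
  where "perm_word p = map p [1, 2, 3, 4]"

definition word_comp :: "nat list \<Rightarrow> nat list \<Rightarrow> nat list"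
  where "word_comp P Q = map (\<lambda>i. P ! (i - 1)) Q"

definition word_inv :: "nat list \<Rightarrow> nat list"
  where "word_inv P = map (\<lambda>i. Suc (length (takeWhile (\<lambda>j. j \<noteq> i) P))) [1, 2, 3, 4]"

definition word_commutator :: "nat list \<Rightarrow> nat list \<Rightarrow> nat list"
  where "word_commutator P Q = word_comp (word_comp (word_comp P Q) (word_inv P)) (word_inv Q)"

definition sym_words :: "nat list list"
  where "sym_words = filter distinct (List.n_lists 4 [1, 2, 3, 4])"

definition klein_words :: "nat list list"
  where "klein_words = [[1, 2, 3, 4], [2, 1, 4, 3], [3, 4, 1, 2], [4, 3, 2, 1]]"

text \<open>
  The alternating group as the product of the powers of a three-cycle with the Klein four-group.
\<close>

definition alt_words :: "nat list list"
  where "alt_words = [word_comp c k. c \<leftarrow> [[1, 2, 3, 4], [2, 3, 1, 4], [3, 1, 2, 4]], k \<leftarrow> klein_words]"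

definition word_subgroup :: "nat list list \<Rightarrow> bool"
  where "word_subgroup X \<longleftrightarrow> [1, 2, 3, 4] \<in> set X
    \<and> (\<forall>P \<in> set X. word_inv P \<in> set X \<and> (\<forall>Q \<in> set X. word_comp P Q \<in> set X))"

definition commutators_in :: "nat list list \<Rightarrow> nat list list \<Rightarrow> bool"
  where "commutators_in X Y \<longleftrightarrow> (\<forall>P \<in> set X. \<forall>Q \<in> set X. word_commutator P Q \<in> set Y)"

lemma word_inv_left: "\<forall>P \<in> set sym_words. word_comp (word_inv P) P = [1, 2, 3, 4]"
  by code_simp

lemma word_subgroup_alt: "word_subgroup alt_words"
  by code_simp

lemma word_subgroup_klein: "word_subgroup klein_words"
  by code_simp

lemma commutators_sym: "commutators_in sym_words alt_words"
  by code_simp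

lemma commutators_alt: "commutators_in alt_words klein_words"
  by code_simp

lemma commutators_klein: "commutators_in klein_words [[1, 2, 3, 4]]"
  by code_simp

lemma word_subgroup_id: "word_subgroup [[1, 2, 3, 4]]"
  by code_simp

lemma points_four: "{1..4} = {1, 2, 3, 4 :: nat}"
  by auto

lemma perm_word_nth:
  assumes "i \<in> {1..4}"
  shows "perm_word p ! (i - 1) = p i"
proof -
  have "i = 1 \<or> i = 2 \<or> i = 3 \<or> i = 4" using assms by auto
  thus ?thesis by (auto simp: perm_word_def numeral_eq_Suc)
qed

lemma perm_word_comp:
  assumes "q permutes {1..4}"
  shows "perm_word (p \<circ> q) = word_comp (perm_word p) (perm_word q)"
proof -
  have "p (q i) = perm_word p ! (q i - 1)" if "i \<in> {1..4}" for i
    using permutes_in_image[OF assms] that perm_word_nth by metis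
  thus ?thesis by (simp add: perm_word_def[of "p \<circ> q"] perm_word_def[of q] word_comp_def)
qed

lemma perm_word_inj:
  assumes "p permutes {1..4}" "q permutes {1..4}" "perm_word p = perm_word q"
  shows "p = q"
proof
  fix i
  show "p i = q i"
  proof (cases "i \<in> {1..4}")
    case True
    thus ?thesis using assms(3) perm_word_nth by metis
  next
    case False
    thus ?thesis using permutes_not_in[OF assms(1)] permutes_not_in[OF assms(2)] by simp
  qed
qed

lemma perm_word_in_sym_words:
  assumes "p permutes {1..4}"
  shows "perm_word p \<in> set sym_words"
proof -
  have "distinct (perm_word p)"
    using permutes_inj[OF assms] by (simp add: perm_word_def inj_eq)
  moreover have "set (perm_word p) \<subseteq> {1, 2, 3, 4}"
    using permutes_in_image[OF assms] points_four by (auto simp: perm_word_def)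
  ultimately show ?thesis by (simp add: sym_words_def set_n_lists) (simp add: perm_word_def)
qed

text \<open>
  The word of the inverse is determined by the computed identity \<open>word_inv_left\<close>, read at the
  places \<open>i = p\<^sup>-\<^sup>1 j\<close>.
\<close>

lemma perm_word_inv:
  assumes p: "p permutes {1..4}"
  shows "perm_word (inv' p) = word_inv (perm_word p)"
proof -
  let ?Q = "word_inv (perm_word p)"
  have "word_comp ?Q (perm_word p) = [1, 2, 3, 4]"
    using word_inv_left perm_word_in_sym_words[OF p] by blast
  hence *: "?Q ! (p i - 1) = i" if "i \<in> {1, 2, 3, 4}" for i
    using that by (auto simp: word_comp_def perm_word_def[of p])
  have "?Q ! (i - 1) = inv' p i" if "i \<in> {1..4}" for i
  proof -
    have "inv' p i \<in> {1, 2, 3, 4}"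
      using permutes_in_image[OF permutes_inv[OF p]] that points_four by blast
    from *[OF this] show ?thesis using permutes_inverses(1)[OF p] by simp
  qed
  from this[of 1] this[of 2] this[of 3] this[of 4]
  have "?Q ! 0 = inv' p 1" "?Q ! 1 = inv' p 2" "?Q ! 2 = inv' p 3" "?Q ! 3 = inv' p 4"
    by simp_all
  moreover have "length ?Q = 4" by (simp add: word_inv_def)
  hence "?Q = [?Q ! 0, ?Q ! 1, ?Q ! 2, ?Q ! 3]"
    by (simp add: list_eq_iff_nth_eq nth_Cons' less_Suc_eq numeral_eq_Suc)
  ultimately have "?Q = [inv' p 1, inv' p 2, inv' p 3, inv' p 4]" by simp
  thus ?thesis by (simp add: perm_word_def[of "inv' p"])
qed

definition word_perms :: "nat list list \<Rightarrow> (nat \<Rightarrow> nat) set"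
  where "word_perms X = {p. p permutes {1..4} \<and> perm_word p \<in> set X}"

lemma word_perms_subgroup:
  assumes X: "word_subgroup X"
  shows "subgroup (word_perms X) (sym_group 4)"
proof -
  interpret S: group "sym_group 4" by (rule sym_group_is_group)
  show ?thesis
  proof (rule S.subgroupI)
    show "word_perms X \<subseteq> carrier (sym_group 4)"
      by (auto simp: word_perms_def sym_group_carrier)
    have "id \<in> word_perms X"
      using X by (simp add: word_perms_def word_subgroup_def perm_word_def permutes_id)
    thus "word_perms X \<noteq> {}" by blast
    show "inv\<^bsub>sym_group 4\<^esub> p \<in> word_perms X" if "p \<in> word_perms X" for p
      using that X
      by (auto simp: word_perms_def sym_group_carrier permutes_inv perm_word_inv word_subgroup_def)
    show "p \<otimes>\<^bsub>sym_group 4\<^esub> q \<in> word_perms X" if "p \<in> word_perms X" "q \<in> word_perms X" for p q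
      using that X
      by (auto simp: word_perms_def sym_group_mult permutes_compose perm_word_comp word_subgroup_def)
  qed
qed

lemma derived_word_perms:
  assumes "commutators_in X Y" "word_subgroup Y"
  shows "derived (sym_group 4) (word_perms X) \<subseteq> word_perms Y"
  unfolding derived_def
proof (rule group.generate_subgroup_incl[OF sym_group_is_group _ word_perms_subgroup[OF assms(2)]])
  show "derived_set (sym_group 4) (word_perms X) \<subseteq> word_perms Y"
  proof clarify
    fix p q assume pq: "p \<in> word_perms X" "q \<in> word_perms X"
    hence perm: "p permutes {1..4}" "q permutes {1..4}" by (auto simp: word_perms_def)
    have eq: "p \<otimes>\<^bsub>sym_group 4\<^esub> q \<otimes>\<^bsub>sym_group 4\<^esub> inv\<^bsub>sym_group 4\<^esub> p \<otimes>\<^bsub>sym_group 4\<^esub> inv\<^bsub>sym_group 4\<^esub> q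
      = p \<circ> q \<circ> inv' p \<circ> inv' q"
      using perm by (simp add: sym_group_mult sym_group_carrier)
    have "p \<circ> q \<circ> inv' p \<circ> inv' q permutes {1..4}"
      using perm by (intro permutes_compose permutes_inv)
    moreover have "perm_word (p \<circ> q \<circ> inv' p \<circ> inv' q) = word_commutator (perm_word p) (perm_word q)"
      using perm by (simp add: perm_word_comp perm_word_inv permutes_inv word_commutator_def)
    ultimately show "p \<otimes>\<^bsub>sym_group 4\<^esub> q \<otimes>\<^bsub>sym_group 4\<^esub> inv\<^bsub>sym_group 4\<^esub> p \<otimes>\<^bsub>sym_group 4\<^esub> inv\<^bsub>sym_group 4\<^esub> q
        \<in> word_perms Y"
      using assms(1) pq unfolding eq by (simp add: word_perms_def commutators_in_def)
  qed
qed

lemma derived_sym_group_4: "(derived (sym_group 4) ^^ 3) (carrier (sym_group 4)) \<subseteq> {id}"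
proof -
  interpret S: group "sym_group 4" by (rule sym_group_is_group)
  let ?d = "derived (sym_group 4)"
  have "carrier (sym_group 4) \<subseteq> word_perms sym_words"
    by (auto simp: sym_group_carrier word_perms_def perm_word_in_sym_words)
  hence "?d (carrier (sym_group 4)) \<subseteq> ?d (word_perms sym_words)" by (rule S.mono_derived)
  also have "\<dots> \<subseteq> word_perms alt_words"
    by (rule derived_word_perms[OF commutators_sym word_subgroup_alt])
  finally have "?d (?d (carrier (sym_group 4))) \<subseteq> ?d (word_perms alt_words)" by (rule S.mono_derived)
  also have "\<dots> \<subseteq> word_perms klein_words"
    by (rule derived_word_perms[OF commutators_alt word_subgroup_klein])
  finally have "?d (?d (?d (carrier (sym_group 4)))) \<subseteq> ?d (word_perms klein_words)"
    by (rule S.mono_derived)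
  also have "\<dots> \<subseteq> word_perms [[1, 2, 3, 4]]"
    by (rule derived_word_perms[OF commutators_klein word_subgroup_id])
  also have "\<dots> \<subseteq> {id}"
    using perm_word_inj[OF _ permutes_id] by (auto simp: word_perms_def perm_word_def[of id])
  finally show ?thesis by (simp add: numeral_3_eq_3)
qed

context finite_group
begin

lemma conjugate_permutes:
  assumes "x \<in> carrier G" "g \<in> carrier G"
  shows "(\<lambda>y. if y \<in> conj_class x then conjugate g y else y) permutes conj_class x"
proof (rule bij_imp_permutes)
  have sub: "conj_class x \<subseteq> carrier G" by (rule conj_class_sub[OF assms(1)])
  have inj: "inj_on (conjugate g) (conj_class x)"
    using sub assms(2) by (intro inj_onI) (auto simp: subset_iff)
  moreover have "conjugate g ` conj_class x \<subseteq> conj_class x"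
    using conj_class_conj[OF assms(2,1)] by blast
  ultimately have "bij_betw (conjugate g) (conj_class x) (conj_class x)"
    by (simp add: bij_betw_def endo_inj_surj)
  thus "bij_betw (\<lambda>y. if y \<in> conj_class x then conjugate g y else y) (conj_class x) (conj_class x)"
    by (simp cong: bij_betw_cong)
qed simp

text \<open>
  Conjugation on a class with at most four elements, transported to \<open>{1..4}\<close>, is a homomorphism to
  the symmetric group on four letters, and it maps derived subgroups to derived subgroups.
\<close>

lemma derived_fixes_small_class:
  assumes x: "x \<in> carrier G" and small: "card (conj_class x) \<le> 4"
    and g: "g \<in> (derived G ^^ 3) (carrier G)" and y: "y \<in> conj_class x"
  shows "conjugate g y = y"
proof -
  define K where "K = conj_class x"
  define act where "act g = (\<lambda>y. if y \<in> K then conjugate g y else y)" for g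
  have perm: "act g permutes K" if "g \<in> carrier G" for g
    using conjugate_permutes[OF x that] by (simp add: act_def K_def)
  obtain f :: "'a \<Rightarrow> nat" where f: "inj_on f K" "f ` K \<subseteq> {1..4}"
    using card_le_inj[of K "{1..4 :: nat}"] small by (auto simp: K_def)
  define h where "h g = map_permutation K f (act g)" for g
  have hp: "h g permutes {1..4}" if "g \<in> carrier G" for g
  proof -
    have "h g permutes f ` K"
      unfolding h_def using f perm[OF that] by (intro map_permutation_permutes) (auto simp: bij_betw_def)
    thus ?thesis using f(2) by (rule permutes_subset)
  qed
  have "h \<in> hom G (sym_group 4)"
  proof (rule homI)
    show "h g \<in> carrier (sym_group 4)" if "g \<in> carrier G" for g
      using hp[OF that] by (simp add: sym_group_carrier)
    show "h (a \<otimes> b) = h a \<otimes>\<^bsub>sym_group 4\<^esub> h b" if ab: "a \<in> carrier G" "b \<in> carrier G" for a b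
    proof -
      have "act (a \<otimes> b) = act a \<circ> act b"
        using ab conj_class_sub[OF x] conj_class_conj[OF ab(2) x]
        by (auto simp: act_def K_def fun_eq_iff conjugate_comp subset_iff)
      thus ?thesis
        unfolding h_def by (simp add: sym_group_mult map_permutation_compose'[OF f(1) perm[OF ab(2)]])
    qed
  qed
  then interpret h: group_hom G "sym_group 4" h
    by (simp add: group_hom_def group_hom_axioms_def sym_group_is_group is_group)
  have "h ` ((derived G ^^ 3) (carrier G)) = (derived (sym_group 4) ^^ 3) (h ` carrier G)"
    by (rule h.exp_of_derived_img[symmetric]) simp
  also have "\<dots> \<subseteq> (derived (sym_group 4) ^^ 3) (carrier (sym_group 4))"
    using h.hom_closed by (intro group.mono_exp_of_derived[OF sym_group_is_group]) auto
  also have "\<dots> \<subseteq> {id}" by (rule derived_sym_group_4)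
  finally have "h g = id" using g by auto
  hence "f (act g y) = f y"
    using map_permutation_apply[OF f(1), of y "act g"] y by (simp add: h_def K_def)
  moreover have "act g y \<in> K"
    using perm[of g] permutes_in_image[of "act g" K y] y exp_of_derived_in_carrier[of "carrier G" 3] g
    by (auto simp: K_def)
  ultimately have "act g y = y" using f(1) y by (auto simp: K_def dest: inj_onD)
  thus ?thesis using y by (simp add: act_def K_def)
qed

text \<open>
  The third derived subgroup of the group generated by the class centralizes the class, hence the whole
  generated group and in particular itself.
\<close>

lemma generate_small_class_solvable:
  assumes x: "x \<in> carrier G" and small: "card (conj_class x) \<le> 4"
  shows "(derived G ^^ 4) (generate G (conj_class x)) \<subseteq> {\<one>}"
proof -
  let ?A = "generate G (conj_class x)" and ?D = "(derived G ^^ 3) (generate G (conj_class x))"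
  have sub: "conj_class x \<subseteq> carrier G" by (rule conj_class_sub[OF x])
  have A: "subgroup ?A G" by (rule generate_is_subgroup[OF sub])
  have DA: "?D \<subseteq> ?A"
  proof -
    have step: "derived G B \<subseteq> ?A" if "B \<subseteq> ?A" for B using derived_incl[OF that A] .
    show ?thesis using step by (simp add: numeral_3_eq_3)
  qed
  have DG: "?D \<subseteq> (derived G ^^ 3) (carrier G)"
    using subgroup.subset[OF A] by (rule mono_exp_of_derived)
  have "?A \<subseteq> cent d" if d: "d \<in> ?D" for d
  proof (rule generate_subgroup_incl)
    have dc: "d \<in> carrier G" using d DA subgroup.subset[OF A] by blast
    show "subgroup (cent d) G" by (rule subgroup_cent[OF dc])
    show "conj_class x \<subseteq> cent d"
    proof
      fix y assume y: "y \<in> conj_class x"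
      hence "conjugate d y = y" using derived_fixes_small_class[OF x small] d DG by blast
      hence "d \<in> cent y" using conjugate_self_iff[OF dc] y sub by blast
      thus "y \<in> cent d" using y sub cent_sym by blast
    qed
  qed
  hence comm: "a \<otimes> b = b \<otimes> a" if "a \<in> ?D" "b \<in> ?D" for a b
    using that DA by (auto simp: cent_def)
  have "derived_set G ?D \<subseteq> {\<one>}"
  proof clarify
    fix a b assume ab: "a \<in> ?D" "b \<in> ?D"
    hence c: "a \<in> carrier G" "b \<in> carrier G" using DA subgroup.subset[OF A] by blast+
    show "a \<otimes> b \<otimes> inv a \<otimes> inv b = \<one>" using c comm[OF ab] by (simp add: m_assoc)
  qed
  hence "derived G ?D \<subseteq> {\<one>}"
    unfolding derived_def by (rule generate_subgroup_incl) (rule triv_subgroup)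
  thus ?thesis by (simp add: numeral_eq_Suc)
qed

end

section \<open>The quotient by the solvable radical\<close>

context finite_group
begin

lemma finite_group_quotient:
  assumes "N \<lhd> G"
  shows "finite_group (G Mod N)"
proof -
  interpret N: normal N G by fact
  interpret Q: group "G Mod N" by (rule N.factorgroup_is_group)
  show ?thesis
    by unfold_locales (simp add: carrier_FactGroup)
qed

lemma order_quotient:
  assumes "N \<lhd> G"
  shows "order (G Mod N) * card N = order G"
proof -
  interpret N: normal N G by fact
  show ?thesis using lagrange[OF N.subgroup_axioms] by (simp add: order_def FactGroup_def)
qed

text \<open>
  Solvability of a subgroup, expressed inside the ambient group so that no group on the subgroup itself has
  to be formed.
\<close>

definition derived_to_one :: "'a set \<Rightarrow> bool"
  where "derived_to_one N \<longleftrightarrow> (\<exists>k. (derived G ^^ k) N \<subseteq> {\<one>})"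

text \<open>
  The preimage \<open>M\<close> of the normal subgroup generated by a small class is again normal with a derived
  series that reaches the trivial group, since its fourth derived subgroup lies in \<open>N\<close>. Maximality of
  \<open>N\<close> gives \<open>M = N\<close>, so the class is trivial.
\<close>

lemma quotient_by_radical:
  assumes N: "N \<lhd> G" "derived_to_one N"
    and max: "\<And>M. M \<lhd> G \<Longrightarrow> derived_to_one M \<Longrightarrow> card M \<le> card N"
    and X: "X \<in> carrier (G Mod N)" "X \<noteq> \<one>\<^bsub>G Mod N\<^esub>"
  shows "5 \<le> card (group.conj_class (G Mod N) X)"
proof (rule ccontr)
  interpret N: normal N G by fact
  interpret Q: finite_group "G Mod N" by (rule finite_group_quotient[OF N(1)])
  interpret q: group_hom G "G Mod N" "\<lambda>x. N #> x"
    using N.r_coset_hom_Mod by (simp add: group_hom_def group_hom_axioms_def is_group Q.is_group)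
  assume "\<not> 5 \<le> card (Q.conj_class X)"
  hence small: "card (Q.conj_class X) \<le> 4" by simp
  define A where "A = generate (G Mod N) (Q.conj_class X)"
  have csub: "Q.conj_class X \<subseteq> carrier (G Mod N)" by (rule Q.conj_class_sub[OF X(1)])
  have normA: "A \<lhd> G Mod N"
    unfolding A_def
  proof (rule Q.normal_generateI[OF csub])
    fix Y Z assume "Y \<in> Q.conj_class X" "Z \<in> carrier (G Mod N)"
    thus "Z \<otimes>\<^bsub>G Mod N\<^esub> Y \<otimes>\<^bsub>G Mod N\<^esub> inv\<^bsub>G Mod N\<^esub> Z \<in> Q.conj_class X"
      using Q.conj_class_conj[OF _ X(1)] by (simp only: Q.conjugate_def)
  qed
  interpret A: normal A "G Mod N" by (rule normA)
  define M where "M = {g \<in> carrier G. N #> g \<in> A}"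
  have M: "M \<lhd> G"
  proof (rule normal_invI)
    show "subgroup M G"
    proof (rule subgroupI)
      show "M \<noteq> {}" using A.one_closed q.hom_one by (auto simp: M_def intro!: exI[of _ \<one>])
      show "inv a \<in> M" if "a \<in> M" for a
        using that A.m_inv_closed q.hom_inv by (auto simp: M_def simp del: q.hom_inv)
      show "a \<otimes> b \<in> M" if "a \<in> M" "b \<in> M" for a b
        using that A.m_closed q.hom_mult by (auto simp: M_def simp del: q.hom_mult)
    qed (auto simp: M_def)
    show "g \<otimes> h \<otimes> inv g \<in> M" if g: "g \<in> carrier G" and h: "h \<in> M" for g h
    proof -
      have hc: "h \<in> carrier G" "N #> h \<in> A" using h by (auto simp: M_def)
      have "N #> (g \<otimes> h \<otimes> inv g)
          = (N #> g) \<otimes>\<^bsub>G Mod N\<^esub> (N #> h) \<otimes>\<^bsub>G Mod N\<^esub> inv\<^bsub>G Mod N\<^esub> (N #> g)"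
        using g hc by (simp only: q.hom_mult q.hom_inv m_closed inv_closed)
      also have "\<dots> \<in> A" using A.inv_op_closed2[OF q.hom_closed[OF g] hc(2)] .
      finally show ?thesis using g hc by (simp add: M_def)
    qed
  qed
  have "(\<lambda>x. N #> x) ` M \<subseteq> A" by (auto simp: M_def)
  hence "(derived (G Mod N) ^^ 4) ((\<lambda>x. N #> x) ` M) \<subseteq> (derived (G Mod N) ^^ 4) A"
    by (rule Q.mono_exp_of_derived)
  also have "\<dots> \<subseteq> {\<one>\<^bsub>G Mod N\<^esub>}"
    unfolding A_def by (rule Q.generate_small_class_solvable[OF X(1) small])
  also have "(derived (G Mod N) ^^ 4) ((\<lambda>x. N #> x) ` M) = (\<lambda>x. N #> x) ` ((derived G ^^ 4) M)"
    by (rule q.exp_of_derived_img) (auto simp: M_def)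
  finally have img: "(\<lambda>x. N #> x) ` ((derived G ^^ 4) M) \<subseteq> {\<one>\<^bsub>G Mod N\<^esub>}" .
  have "(derived G ^^ 4) M \<subseteq> N"
  proof
    fix x assume x: "x \<in> (derived G ^^ 4) M"
    hence "x \<in> carrier G" using exp_of_derived_in_carrier[of M 4] by (auto simp: M_def)
    moreover have "N #> x = N" using x img by auto
    ultimately show "x \<in> N" using coset_join1 N.subgroup_axioms by blast
  qed
  moreover obtain k where "(derived G ^^ k) N \<subseteq> {\<one>}" using N(2) by (auto simp: derived_to_one_def)
  ultimately have "(derived G ^^ k) ((derived G ^^ 4) M) \<subseteq> {\<one>}"
    using mono_exp_of_derived by blast
  hence "derived_to_one M" unfolding derived_to_one_def by (metis funpow_add comp_apply)
  hence le: "card M \<le> card N" using max M by blast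
  have "N \<subseteq> M"
    using N.subset A.one_closed coset_join2[OF _ N.subgroup_axioms] by (auto simp: M_def)
  moreover have "finite M" by (rule finite_sub) (auto simp: M_def)
  ultimately have "M = N" using le card_seteq by blast
  obtain g where g: "g \<in> carrier G" "X = N #> g" using X(1) by (auto simp: carrier_FactGroup)
  have "X \<in> A" unfolding A_def using Q.self_in_conj_class[OF X(1)] by (rule generate.incl)
  hence "g \<in> N" using g \<open>M = N\<close> by (auto simp: M_def)
  hence "X = \<one>\<^bsub>G Mod N\<^esub>" using g coset_join2[OF _ N.subgroup_axioms] by simp
  thus False using X(2) by simp
qed

text \<open>
  The quotient by the largest normal subgroup with terminating derived series inherits the bound on the
  average order and has no small classes, so it is trivial.
\<close>

theorem solvable_of_small_psi:
  assumes small: "4 * psi G < 11 * order G"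
  shows "solvable G"
proof -
  let ?S = "\<lambda>N. N \<lhd> G \<and> derived_to_one N"
  have "?S {\<one>}"
    using one_is_normal by (auto simp: derived_to_one_def intro!: exI[of _ 0])
  moreover have "card N < order G + 1" if "?S N" for N
    using that card_mono[OF finite_carrier, of N] normal_imp_subgroup subgroup.subset
    by (force simp: order_def)
  ultimately obtain N where N: "?S N" and max: "\<And>M. ?S M \<Longrightarrow> card M \<le> card N"
    using ex_has_greatest_nat[of ?S "{\<one>}" card "order G + 1"] by blast
  interpret N: normal N G using N by simp
  interpret Q: finite_group "G Mod N" using N finite_group_quotient by blast
  have oN: "order (G Mod N) * card N = order G" using N order_quotient by blast
  have "4 * psi (G Mod N) * card N \<le> 4 * psi G" using N psi_quotient_le by simp
  also have "\<dots> < 11 * order (G Mod N) * card N" using small oN by (simp add: mult.assoc)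
  finally have small': "4 * psi (G Mod N) < 11 * order (G Mod N)" by simp
  interpret Q: many_involutions "G Mod N"
  proof
    show "order (G Mod N) + 4 * card Q.high_ord < 4 * card Q.sq_one + 4"
      using Q.psi_lower_bound small' by linarith
    show "5 * card (Q.cent X) \<le> order (G Mod N)"
      if X: "X \<in> carrier (G Mod N)" "X \<noteq> \<one>\<^bsub>G Mod N\<^esub>" for X
    proof -
      have "5 \<le> card (Q.conj_class X)"
        using quotient_by_radical[OF _ _ _ X] N max by blast
      hence "5 * card (Q.cent X) \<le> card (Q.conj_class X) * card (Q.cent X)" by (rule mult_right_mono) simp
      thus ?thesis using Q.card_conj_class_cent[OF X(1)] by simp
    qed
  qed
  have "card N = card (carrier G)" using Q.order_eq_one oN by (simp add: order_def)
  hence "N = carrier G" using N.subset by (intro card_subset_eq) auto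
  then obtain k where "(derived G ^^ k) (carrier G) \<subseteq> {\<one>}" using N by (auto simp: derived_to_one_def)
  moreover have "\<one> \<in> (derived G ^^ k) (carrier G)"
    using subgroup.one_closed[OF exp_of_derived_is_subgroup[OF subgroup_self]] .
  ultimately have "(derived G ^^ k) (carrier G) = {\<one>}" by blast
  thus ?thesis using solvable_iff_trivial_derived_seq by blast
qed

end

lemma (in group) ord_prime:
  assumes "x \<in> carrier G" "x \<noteq> \<one>" "x [^] (p::nat) = \<one>" "prime p"
  shows "ord x = p"
proof -
  have "ord x dvd p" using assms pow_eq_id by simp
  moreover have "ord x \<noteq> 1" using assms ord_eq_1 by simp
  ultimately show ?thesis using assms(4) by (auto simp: prime_nat_iff)
qed

lemma avg_order_sym_group_3: "avg_order (sym_group 3) = 13 / 6"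
proof -
  interpret S: group "sym_group 3" by (rule sym_group_is_group)
  define a b c where "a = transpose 1 (2::nat)" and "b = transpose 1 (3::nat)" and "c = transpose 2 (3::nat)"
  \<comment> \<open>distinctness of these permutations is read off from their values\<close>
  define ps where "ps = [id, a, b, c, a \<circ> c, c \<circ> a]"
  have "distinct (map (\<lambda>p. (p 1, p 2, p 3)) ps)"
    by (simp add: ps_def a_def b_def c_def transpose_def)
  hence dist: "distinct ps" by (simp only: distinct_map)
  have perm: "a permutes {1..3}" "b permutes {1..3}" "c permutes {1..3}"
    by (auto simp: a_def b_def c_def intro!: permutes_swap_id)
  have "set ps \<subseteq> carrier (sym_group 3)"
    using perm by (auto simp: ps_def sym_group_carrier permutes_id intro: permutes_compose)
  moreover have "card (set ps) = 6" using distinct_card[OF dist] by (simp add: ps_def)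
  moreover have ord6: "card (carrier (sym_group 3)) = 6" by (simp add: sym_group_card_carrier fact_numeral)
  ultimately have carr: "carrier (sym_group 3) = set ps"
    by (intro card_subset_eq[symmetric]) (auto intro: card_ge_0_finite)
  have sq: "a \<circ> a = id" "b \<circ> b = id" "c \<circ> c = id" by (simp_all add: a_def b_def c_def)
  have ne: "p \<noteq> id" if "p \<in> {a, b, c, a \<circ> c, c \<circ> a}" for p
    using dist that by (auto simp: ps_def)
  have two: "S.ord p = 2" if "p \<in> {a, b, c}" for p
    using that sq ne carr
    by (intro S.ord_prime[OF _ _ _ two_is_prime_nat])
      (auto simp: ps_def sym_group_mult sym_group_one numeral_2_eq_2)
  have cube: "(a \<circ> c) \<circ> (a \<circ> c) \<circ> (a \<circ> c) = id" "(c \<circ> a) \<circ> (c \<circ> a) \<circ> (c \<circ> a) = id"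
    by (auto simp: fun_eq_iff a_def c_def transpose_def)
  have prime3: "prime (3::nat)" by simp
  have three: "S.ord p = 3" if "p \<in> {a \<circ> c, c \<circ> a}" for p
    using that cube ne carr
    by (intro S.ord_prime[OF _ _ _ prime3])
      (auto simp: ps_def sym_group_mult sym_group_one numeral_3_eq_3)
  have "S.ord id = 1" using S.ord_id by (simp add: sym_group_one)
  hence "psi (sym_group 3) = 13"
    unfolding psi_def carr using two three
    by (subst sum.distinct_set_conv_list[OF dist]) (simp add: ps_def)
  thus ?thesis by (simp add: avg_order_def order_def ord6)
qed

lemma avg_order_integer_mod_group_4: "avg_order (integer_mod_group 4) = 11 / 4"
proof -
  interpret Z: group "integer_mod_group 4" by simp
  have carr: "carrier (integer_mod_group 4) = {0, 1, 2, 3}"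
    by (auto simp: carrier_integer_mod_group)
  have "Z.ord 0 = 1" using Z.ord_id by simp
  moreover have "(int n mod 4 = 0) = (4 dvd n)" "(int n * 2 mod 4 = 0) = (2 dvd n)"
    "(int n * 3 mod 4 = 0) = (4 dvd n)" for n
    by presburger+
  hence "Z.ord 1 = 4" "Z.ord 2 = 2" "Z.ord 3 = 4"
    by (simp_all add: Z.ord_unique carr)
  ultimately have "psi (integer_mod_group 4) = 11"
    unfolding psi_def carr by simp
  thus ?thesis by (simp add: avg_order_def order_def carr)
qed

theorem theorem1p5:
  fixes G :: "('a, 'b) monoid_scheme"
  assumes "group G" and "finite (carrier G)"
  shows "(avg_order (sym_group 3) = 13 / 6 \<and>
           (avg_order G < 13 / 6 \<longrightarrow> elementary_abelian_2_group G)) \<and>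
         (avg_order (integer_mod_group 4) = 11 / 4 \<and>
           (avg_order G < 11 / 4 \<longrightarrow> solvable G))"
proof -
  interpret group G by fact
  interpret finite_group G by unfold_locales fact
  have pos: "0 < real (order G)" by (simp add: order_gt_0_iff_finite)
  have "elementary_abelian_2_group G" if "avg_order G < 13 / 6"
  proof -
    have "6 * real (psi G) < 13 * real (order G)"
      using that pos by (simp add: avg_order_def divide_simps)
    hence "6 * psi G < 13 * order G" by linarith
    thus ?thesis
      using exponent_two_elementary[OF is_group finite_carrier] exponent_two_of_small_psi by blast
  qed
  moreover have "solvable G" if "avg_order G < 11 / 4"
  proof -
    have "4 * real (psi G) < 11 * real (order G)"
      using that pos by (simp add: avg_order_def divide_simps)
    hence "4 * psi G < 11 * order G" by linarith
    thus ?thesis by (rule solvable_of_small_psi)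
  qed
  ultimately show ?thesis
    using avg_order_sym_group_3 avg_order_integer_mod_group_4 by blast
qed

end
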